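(* Let $m\ge 3$ be an odd integer, let $n$ be an integer with $n\ge 2m-4$, and let $T_n$ be an arbitrary tree on $n$ vertices. Then $$R(T_n,C_m)=2n-1.$$
   Context: All graphs are finite and simple. $C_m$ denotes the cycle on $m$ vertices (so of length $m$), and $K_N$ denotes the complete graph on $N$ vertices. For graphs $G$ and $H$, the Ramsey number $R(G,H)$ is the smallest positive integer $N$ such that every red-blue coloring of the edges of $K_N$ contains either a red subgraph isomorphic to $G$ or a blue subgraph isomorphic to $H$ (subgraphs are not required to be induced). *)

theory Defs
  imports "HOL-Library.Ramsey"
begin

record 'a ugraph =
  verts :: "'a set"
  edges :: "'a set set"

definition simple_graph :: "'a ugraph \<Rightarrow> bool" where
  "simple_graph G \<longleftrightarrow> finite (verts G) \<and> edges G \<subseteq> [verts G]\<^bsup>2\<^esup>"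

definition subgraph :: "'a ugraph \<Rightarrow> 'a ugraph \<Rightarrow> bool" where
  "subgraph H G \<longleftrightarrow> simple_graph H \<and> verts H \<subseteq> verts G \<and> edges H \<subseteq> edges G"

definition isomorphic :: "'a ugraph \<Rightarrow> 'b ugraph \<Rightarrow> bool" where
  "isomorphic G H \<longleftrightarrow>
     (\<exists>f. bij_betw f (verts G) (verts H) \<and>
        (\<forall>u\<in>verts G. \<forall>v\<in>verts G. {u, v} \<in> edges G \<longleftrightarrow> {f u, f v} \<in> edges H))"

definition contains_copy :: "'b ugraph \<Rightarrow> 'a ugraph \<Rightarrow> bool" where
  "contains_copy G H \<longleftrightarrow> (\<exists>H'. subgraph H' G \<and> isomorphic H H')"

definition complete_graph :: "nat \<Rightarrow> nat ugraph" where
  "complete_graph N = \<lparr>verts = {..<N}, edges = [{..<N}]\<^bsup>2\<^esup>\<rparr>"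

(* Only meaningful for m >= 3: for smaller m the set of edges degenerates. *)
definition cycle_graph :: "nat \<Rightarrow> nat ugraph" where
  "cycle_graph m = \<lparr>verts = {..<m}, edges = {{i, (i + 1) mod m} | i. i < m}\<rparr>"

definition connected_graph :: "'a ugraph \<Rightarrow> bool" where
  "connected_graph G \<longleftrightarrow>
     verts G \<noteq> {} \<and> (\<forall>u\<in>verts G. \<forall>v\<in>verts G. (u, v) \<in> {(x, y). {x, y} \<in> edges G}\<^sup>*)"

definition acyclic_graph :: "'a ugraph \<Rightarrow> bool" where
  "acyclic_graph G \<longleftrightarrow> (\<forall>k\<ge>3. \<not> contains_copy G (cycle_graph k))"

definition tree :: "'a ugraph \<Rightarrow> bool" where
  "tree G \<longleftrightarrow> simple_graph G \<and> connected_graph G \<and> acyclic_graph G"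

datatype colour = Red | Blue

(* A colouring is a total function on sets; its values outside edges G play no role. *)
definition colour_class :: "'a ugraph \<Rightarrow> ('a set \<Rightarrow> colour) \<Rightarrow> colour \<Rightarrow> 'a ugraph" where
  "colour_class G c k = \<lparr>verts = verts G, edges = {e \<in> edges G. c e = k}\<rparr>"

(* For finite simple graphs G and H, Ramsey's theorem guarantees that such an N exists. *)
definition ramsey_number :: "'a ugraph \<Rightarrow> 'b ugraph \<Rightarrow> nat" where
  "ramsey_number G H =
     (LEAST N. 0 < N \<and>
        (\<forall>c :: nat set \<Rightarrow> colour.
           contains_copy (colour_class (complete_graph N) c Red) G \<or>
           contains_copy (colour_class (complete_graph N) c Blue) H))"

end

theory Submission
  imports Defs
begin

text \<open>
  Put \<open>k = m - 2\<close>. We show more generally, for every forest \<open>F\<close> on \<open>n\<close> vertices and every odd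
  \<open>k\<close>, that a colouring of at least \<open>max (2 n - 1) (n + 2 k - 1)\<close> vertices contains a red \<open>F\<close> or a
  blue cycle of length \<open>k + 2\<close>. The proof is by induction on \<open>k\<close> and, for fixed \<open>k\<close>, on \<open>n\<close>. Suppose
  both are missing. By induction on \<open>k\<close> there is a blue cycle \<open>c\<close> of length \<open>k\<close>. A blue path on
  \<open>k + 1\<close> vertices outside \<open>c\<close> all of which have blue neighbours on \<open>c\<close> could be spliced into \<open>c\<close>
  (pigeonhole), and a large set without such a path contains a complete bipartite red graph that hosts
  \<open>F\<close>. Hence the set \<open>X0\<close> of vertices outside \<open>c\<close> without blue neighbour on \<open>c\<close> is nonempty. The
  induction hypothesis for \<open>F\<close> minus a pendant star shows that two vertices joined by a red edge have a
  common blue neighbour. For \<open>w\<close> in \<open>X0\<close> the common neighbours of \<open>w\<close> with \<open>c i\<close> and with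
  \<open>c (i + 2)\<close> must coincide, as otherwise \<open>c\<close> could be lengthened by two; since \<open>k\<close> is odd they are
  all one vertex \<open>p\<close>, and it follows that \<open>p\<close> separates \<open>X0\<close> from all other vertices in blue. The
  red complete bipartite graph between the two sides then yields \<open>F\<close>, again by induction on \<open>n\<close>.
\<close>

section \<open>Cycles and forests\<close>

text \<open>\<open>B\<close> is the blue relation, and red is its complement on pairs of distinct
  vertices, so a single relation describes the colouring. For irreflexive \<open>E\<close>,
  injectivity of \<open>f\<close> turns every edge into such a pair, hence into a red edge.\<close>

definition embeds_off :: "'a set \<Rightarrow> ('a \<Rightarrow> 'a \<Rightarrow> bool) \<Rightarrow> 'v set \<Rightarrow> ('v \<Rightarrow> 'v \<Rightarrow> bool) \<Rightarrow> bool" where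
  "embeds_off U E V B \<longleftrightarrow>
     (\<exists>f. inj_on f U \<and> f ` U \<subseteq> V \<and> (\<forall>x\<in>U. \<forall>y\<in>U. E x y \<longrightarrow> \<not> B (f x) (f y)))"

text \<open>Cycles are traversed by periodic functions, so that indices need no reduction modulo \<open>k\<close>.\<close>

definition cyc :: "('v \<Rightarrow> 'v \<Rightarrow> bool) \<Rightarrow> 'v set \<Rightarrow> nat \<Rightarrow> (nat \<Rightarrow> 'v) \<Rightarrow> bool" where
  "cyc B V k c \<longleftrightarrow>
     range c \<subseteq> V \<and> (\<forall>i j. c i = c j \<longleftrightarrow> i mod k = j mod k) \<and> (\<forall>i. B (c i) (c (Suc i)))"

definition has_cycle :: "('v \<Rightarrow> 'v \<Rightarrow> bool) \<Rightarrow> 'v set \<Rightarrow> nat \<Rightarrow> bool" where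
  "has_cycle B V k \<longleftrightarrow> (\<exists>c. cyc B V k c)"

text \<open>This form of acyclicity is inherited by all subsets of the vertices.\<close>

definition forest :: "'a set \<Rightarrow> ('a \<Rightarrow> 'a \<Rightarrow> bool) \<Rightarrow> bool" where
  "forest U E \<longleftrightarrow> finite U \<and> symp E \<and> irreflp E \<and>
     (\<forall>S\<subseteq>U. S \<noteq> {} \<longrightarrow> (\<exists>v\<in>S. card {u \<in> S. E v u} \<le> 1))"

lemma has_cycle_list:
  assumes "distinct ys" "ys \<noteq> []" "set ys \<subseteq> V" "successively B ys" "B (last ys) (hd ys)"
  shows "has_cycle B V (length ys)"
proof -
  let ?k = "length ys"
  let ?c = "\<lambda>i. ys ! (i mod ?k)"
  have k: "?k > 0" using assms(2) by simp
  have step: "B (?c i) (?c (Suc i))" for i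
  proof (cases "Suc (i mod ?k) = ?k")
    case True
    then have "Suc i mod ?k = 0" by (simp add: mod_Suc)
    moreover have "i mod ?k = ?k - 1" using True by simp
    ultimately show ?thesis using assms(2,5) by (simp add: last_conv_nth hd_conv_nth)
  next
    case False
    then have "Suc i mod ?k = Suc (i mod ?k)" by (simp add: mod_Suc)
    moreover have "Suc (i mod ?k) < ?k"
      using False k by (meson Suc_lessI mod_less_divisor)
    ultimately show ?thesis using assms(4) by (simp add: successively_conv_nth)
  qed
  have "cyc B V ?k ?c"
    unfolding cyc_def using assms(1,3) k step by (auto simp: nth_eq_iff_index_eq)
  then show ?thesis unfolding has_cycle_def by blast
qed

lemma successively_map_upt:
  assumes "\<And>i. B (c i) (c (Suc i))"
  shows "successively B (map c [a..<b])"
  using assms by (simp add: successively_conv_nth)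

lemma distinct_map_cyc_upt:
  assumes "cyc B V k c" "b \<le> a + k"
  shows "distinct (map c [a..<b])"
proof -
  have "i = j" if "a \<le> i" "i < b" "a \<le> j" "j < b" "i mod k = j mod k" for i j
  proof -
    have aux: "i = j" if "i \<le> j" "j < i + k" "i mod k = j mod k" for i j :: nat
    proof -
      have "k dvd j - i" using that(1,3) mod_eq_dvd_iff_nat[of i j k] by simp
      moreover have "j - i < k" using that(1,2) by linarith
      ultimately have "j - i = 0" using nat_dvd_not_less by blast
      then show ?thesis using that(1) by simp
    qed
    show ?thesis
    proof (cases "i \<le> j")
      case True
      moreover have "j < i + k" using that assms(2) by linarith
      ultimately show ?thesis using that(5) by (rule aux)
    next
      case False
      then have "j \<le> i" by simp
      moreover have "i < j + k" using that assms(2) by linarith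
      ultimately have "j = i" using that(5)[symmetric] by (rule aux)
      then show ?thesis by simp
    qed
  qed
  then show ?thesis
    using assms(1) unfolding cyc_def distinct_map inj_on_def by simp
qed

text \<open>The path replaces an arc with \<open>j - 1\<close> inner vertices by \<open>j + 1\<close> vertices.\<close>

lemma cyc_reroute:
  assumes c: "cyc B V k c"
    and xs: "distinct xs" "set xs \<subseteq> V" "set xs \<inter> range c = {}" "successively B xs"
      "length xs = Suc j"
    and j: "j \<ge> 1" "j \<le> k"
    and ends: "B (c f) (hd xs)" "B (last xs) (c (f + j))"
  shows "has_cycle B V (k + 2)"
proof -
  \<comment> \<open>The arc that is kept runs from \<open>c (f + j)\<close> forward to
    \<open>c (f + k) = c f\<close>. For \<open>j = k\<close> it shrinks to the single vertex
    \<open>c f\<close>, to which both ends of \<open>xs\<close> are then attached.\<close>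
  define cs where "cs = map c [f + j..<Suc (f + k)]"
  have ne: "xs \<noteq> []" using xs(5) by auto
  have "cs = c (f + j) # map c [Suc (f + j)..<Suc (f + k)]"
    unfolding cs_def using j by (simp only: upt_conv_Cons list.map)
  then have hd: "hd cs = c (f + j)" by simp
  have "cs = map c [f + j..<f + k] @ [c (f + k)]"
    unfolding cs_def using j by simp
  moreover have "c (f + k) = c f" using c unfolding cyc_def by simp
  ultimately have last: "last cs = c f" by simp
  have cs: "successively B cs"
    unfolding cs_def using c unfolding cyc_def by (intro successively_map_upt) simp
  have len: "length cs = Suc (k - j)" unfolding cs_def using j by (simp add: Suc_diff_le)
  then have cs_ne: "cs \<noteq> []" using j by auto
  have dist: "distinct cs"
    unfolding cs_def by (rule distinct_map_cyc_upt[OF c]) (use j in simp)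
  have sub: "set cs \<subseteq> range c" unfolding cs_def by auto
  have "has_cycle B V (length (xs @ cs))"
  proof (rule has_cycle_list)
    show "distinct (xs @ cs)" using dist xs(1,3) sub by auto
    show "xs @ cs \<noteq> []" using ne by simp
    show "set (xs @ cs) \<subseteq> V" using xs(2) sub c unfolding cyc_def by auto
    show "successively B (xs @ cs)"
      unfolding successively_append_iff using xs(4) cs ends(2) hd by simp
    show "B (last (xs @ cs)) (hd (xs @ cs))" using ends(1) cs_ne last ne by simp
  qed
  moreover have "length (xs @ cs) = k + 2" using xs(5) len j by simp
  ultimately show ?thesis by simp
qed

section \<open>Two-colourings of forests, and sets without long paths\<close>

lemma forest_subset: "forest U E \<Longrightarrow> W \<subseteq> U \<Longrightarrow> forest W E"
  unfolding forest_def using finite_subset by (meson order_trans)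

text \<open>Colour everything except a vertex with at most one neighbour by induction; that vertex
  takes the colour its neighbour lacks. The two classes are later sent to the two sides of a red
  complete bipartite graph.\<close>

lemma forest_two_colouring:
  assumes "forest U E"
  shows "\<exists>col :: 'a \<Rightarrow> bool. \<forall>x\<in>U. \<forall>y\<in>U. E x y \<longrightarrow> col x \<noteq> col y"
proof -
  have "finite U" using assms by (simp add: forest_def)
  then show ?thesis using assms
  proof (induction U rule: finite_psubset_induct)
    case (psubset U)
    have sym: "E x y \<Longrightarrow> E y x" and irr: "\<not> E x x" for x y
      using psubset.prems by (auto simp: forest_def symp_def irreflp_def)
    show ?case
    proof (cases "U = {}")
      case False
      then obtain v where v: "v \<in> U" "card {u \<in> U. E v u} \<le> 1"
        using psubset.prems unfolding forest_def by blast
      have "forest (U - {v}) E" using psubset.prems forest_subset by blast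
      then obtain col :: "'a \<Rightarrow> bool" where
        col: "\<forall>x\<in>U - {v}. \<forall>y\<in>U - {v}. E x y \<longrightarrow> col x \<noteq> col y"
        using psubset.IH[of "U - {v}"] v(1) by blast
      obtain b where b: "\<forall>u\<in>U. E v u \<longrightarrow> col u \<noteq> b"
      proof (cases "{u \<in> U. E v u} = {}")
        case True
        then show ?thesis using that by blast
      next
        case False
        then have "card {u \<in> U. E v u} > 0"
          using psubset.hyps by (simp add: card_gt_0_iff)
        then have "card {u \<in> U. E v u} = 1" using v(2) by linarith
        then obtain t where t: "{u \<in> U. E v u} = {t}" using card_1_singletonE by blast
        have "u = t" if "u \<in> U" "E v u" for u using t that by blast
        then show ?thesis using that[of "\<not> col t"] by fastforce
      qed
      have "\<forall>x\<in>U. \<forall>y\<in>U. E x y \<longrightarrow> (col(v := b)) x \<noteq> (col(v := b)) y"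
      proof (intro ballI impI)
        fix x y assume xy: "x \<in> U" "y \<in> U" "E x y"
        consider "x = v" "y \<noteq> v" | "y = v" "x \<noteq> v" | "x \<noteq> v" "y \<noteq> v"
          using xy(3) irr by blast
        then show "(col(v := b)) x \<noteq> (col(v := b)) y"
        proof cases
          case 1
          then show ?thesis using b xy by simp
        next
          case 2
          then show ?thesis using b xy sym[OF xy(3)] by simp
        next
          case 3
          then show ?thesis using col xy by simp
        qed
      qed
      then show ?thesis by (intro exI)
    qed simp
  qed
qed

text \<open>Depth-first search: \<open>F\<close> is the set of finished vertices and \<open>xs\<close> the current path.\<close>

lemma path_free_imp_hole:
  assumes fin: "finite Q"
    and free: "\<nexists>xs. distinct xs \<and> set xs \<subseteq> Q \<and> successively B xs \<and> length xs = Suc w"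
    and sym: "symp B" and w: "w \<ge> 1" and card: "card Q + 1 \<ge> p + r + w"
  shows "\<exists>F W. F \<subseteq> Q \<and> W \<subseteq> Q \<and> F \<inter> W = {} \<and> card F = p \<and> card W = r \<and> (\<forall>x\<in>F. \<forall>y\<in>W. \<not> B x y)"
proof -
  \<comment> \<open>The head of \<open>xs\<close> is the tip of the search. No blue edge joins a
    finished vertex to an unvisited one, so in the end \<open>F\<close> and the unvisited vertices
    yield the hole.\<close>
  define state where "state F xs \<longleftrightarrow> F \<subseteq> Q \<and> distinct xs \<and> set xs \<subseteq> Q - F \<and> successively B xs \<and>
    (\<forall>x\<in>F. \<forall>y\<in>Q - F - set xs. \<not> B x y)" for F xs
  have short: "length xs \<le> w" if "state F xs" for F xs
  proof (rule ccontr)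
    assume "\<not> length xs \<le> w"
    then have "distinct (take (Suc w) xs) \<and> set (take (Suc w) xs) \<subseteq> Q \<and>
        successively B (take (Suc w) xs) \<and> length (take (Suc w) xs) = Suc w"
      using that set_take_subset[of "Suc w" xs] unfolding state_def
      by (auto simp: successively_conv_nth)
    then show False using free by blast
  qed
  \<comment> \<open>Each round prolongs the path to a longest one, whose head has no unvisited
    neighbour, and moves this head to \<open>F\<close>. The longest path has at most
    \<open>w\<close> vertices, so at most \<open>w - 1\<close> stay on the path.\<close>
  have "i \<le> card Q \<Longrightarrow> \<exists>F xs. state F xs \<and> card F = i \<and> Suc (length xs) \<le> w" for i
  proof (induction i)
    case 0
    have "state {} []" unfolding state_def by simp
    then show ?case using w by (intro exI[of _ "{}"] exI[of _ "[]"]) auto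
  next
    case (Suc i)
    then obtain F xs where F: "state F xs" "card F = i" by auto
    have "\<exists>ys. state F ys \<and> (\<forall>zs. state F zs \<longrightarrow> length zs \<le> length ys)"
      using F(1) short by (intro ex_has_greatest_nat[where b = "Suc w"]) (auto simp: less_Suc_eq_le)
    then obtain ys where ys: "state F ys" and max: "\<And>zs. state F zs \<Longrightarrow> length zs \<le> length ys"
      by blast
    have FQ': "F \<subseteq> Q" using ys by (simp add: state_def)
    then have finF: "finite F" using fin finite_subset by blast
    have "F \<noteq> Q" using F(2) Suc.prems by auto
    then have FQ: "F \<subset> Q" using FQ' by blast
    have grow: "state F (y # ys)" if "y \<in> Q - F - set ys" "ys = [] \<or> B y (hd ys)" for y
      using ys that unfolding state_def by (auto simp: successively_Cons)
    have ne: "ys \<noteq> []"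
    proof
      assume "ys = []"
      moreover from this obtain y where "y \<in> Q - F - set ys" using FQ by auto
      ultimately show False using grow[of y] max[of "y # ys"] by simp
    qed
    have nb: "\<not> B (hd ys) y" if "y \<in> Q - F - set ys" for y
    proof
      assume "B (hd ys) y"
      then have "B y (hd ys)" using sym by (rule sympD[rotated])
      then show False using grow[OF that] max[of "y # ys"] by simp
    qed
    obtain a as where ya: "ys = a # as" using ne by (cases ys) auto
    have "state (insert a F) as"
      using ys nb unfolding state_def ya by (auto simp: successively_Cons)
    moreover have "card (insert a F) = Suc i"
      using F(2) finF ys unfolding state_def ya by simp
    moreover have "Suc (length as) \<le> w" using short[OF ys] ya by simp
    ultimately show ?case by blast
  qed
  moreover have "p \<le> card Q" using card w by simp
  ultimately obtain F xs where F: "state F xs" "card F = p" "Suc (length xs) \<le> w" by blast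
  have FQ: "F \<subseteq> Q" "set xs \<subseteq> Q - F" using F(1) unfolding state_def by auto
  \<comment> \<open>Besides \<open>F\<close>, at most \<open>w - 1\<close> path vertices are lost;
    this accounts for the \<open>+ 1\<close> in the assumption on \<open>card Q\<close>.\<close>
  have "card (Q - F - set xs) = card Q - p - card (set xs)"
    using FQ F(2) fin by (simp add: card_Diff_subset finite_subset)
  moreover have "card (set xs) < w" using F(3) card_length[of xs] by linarith
  ultimately have "r \<le> card (Q - F - set xs)" using card by linarith
  then obtain W where "W \<subseteq> Q - F - set xs" "card W = r" by (meson obtain_subset_with_card_n)
  then show ?thesis using F FQ unfolding state_def by (intro exI[of _ F] exI[of _ W]) auto
qed

section \<open>Embedding forests\<close>

lemma embeds_offI:
  assumes "inj_on f U" "f ` U \<subseteq> V" "\<And>x y. x \<in> U \<Longrightarrow> y \<in> U \<Longrightarrow> E x y \<Longrightarrow> \<not> B (f x) (f y)"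
  shows "embeds_off U E V B"
  unfolding embeds_off_def using assms by blast

lemma embeds_off_edgeless:
  assumes "finite U" "finite V" "card U \<le> card V" "\<And>x y. x \<in> V \<Longrightarrow> y \<in> V \<Longrightarrow> x \<noteq> y \<Longrightarrow> \<not> B x y"
    and "irreflp E"
  shows "embeds_off U E V B"
proof -
  obtain f where f: "inj_on f U" "f ` U \<subseteq> V"
    using card_le_inj[OF assms(1-3)] by blast
  show ?thesis
  proof (rule embeds_offI[OF f])
    fix x y assume xy: "x \<in> U" "y \<in> U" "E x y"
    then have "x \<noteq> y" using assms(5) by (auto simp: irreflp_def)
    then have "f x \<noteq> f y" using xy f(1) by (simp add: inj_on_eq_iff)
    then show "\<not> B (f x) (f y)" using assms(4) f(2) xy by blast
  qed
qed

lemma embeds_off_bipartite: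
  assumes "finite P" "finite Q" "finite M" "finite N" "card P \<le> card M" "card Q \<le> card N"
    and disj: "P \<inter> Q = {}" "M \<inter> N = {}"
    and indep: "\<And>x y. x \<in> P \<Longrightarrow> y \<in> P \<Longrightarrow> \<not> E x y" "\<And>x y. x \<in> Q \<Longrightarrow> y \<in> Q \<Longrightarrow> \<not> E x y"
    and hole: "\<And>x y. x \<in> M \<Longrightarrow> y \<in> N \<Longrightarrow> \<not> B x y" and sym: "symp B"
    and sub: "M \<subseteq> V" "N \<subseteq> V"
  shows "embeds_off (P \<union> Q) E V B"
proof -
  obtain f where f: "inj_on f P" "f ` P \<subseteq> M" using card_le_inj[OF assms(1,3,5)] by blast
  obtain g where g: "inj_on g Q" "g ` Q \<subseteq> N" using card_le_inj[OF assms(2,4,6)] by blast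
  define h where "h x = (if x \<in> P then f x else g x)" for x
  have fP: "h x = f x" if "x \<in> P" for x using that by (simp add: h_def)
  have gQ: "h x = g x" if "x \<in> Q" for x using that disj(1) by (auto simp: h_def)
  have hP: "h x \<in> M" if "x \<in> P" for x using that f(2) fP by auto
  have hQ: "h x \<in> N" if "x \<in> Q" for x using that g(2) gQ by auto
  show ?thesis
  proof (rule embeds_offI)
    have "inj_on h P" using f(1) fP by (simp add: inj_on_def)
    moreover have "inj_on h Q" using g(1) gQ by (simp add: inj_on_def)
    moreover have "h ` P \<inter> h ` Q = {}"
    proof -
      have "h ` P \<subseteq> M" "h ` Q \<subseteq> N" using hP hQ by auto
      then show ?thesis using disj(2) by blast
    qed
    ultimately show "inj_on h (P \<union> Q)" unfolding inj_on_Un by blast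
    show "h ` (P \<union> Q) \<subseteq> V" using hP hQ sub by auto
    fix x y assume xy: "x \<in> P \<union> Q" "y \<in> P \<union> Q" "E x y"
    then consider "x \<in> P" "y \<in> Q" | "x \<in> Q" "y \<in> P" using indep by blast
    then show "\<not> B (h x) (h y)"
    proof cases
      case 1
      show ?thesis by (rule hole[OF hP[OF 1(1)] hQ[OF 1(2)]])
    next
      case 2
      show ?thesis using hole[OF hP[OF 2(2)] hQ[OF 2(1)]] sympD[OF sym] by blast
    qed
  qed
qed

text \<open>The vertex \<open>x\<close> receives the centre \<open>t\<close>, and \<open>D\<close>
  receives the leaves \<open>L\<close>. An edge at a leaf ends in \<open>t\<close>, so the only new
  edges run from \<open>x\<close> to \<open>D\<close> and from \<open>x\<close> to the images of the
  other neighbours of \<open>t\<close>.\<close>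

lemma embeds_off_add_star:
  assumes g: "inj_on g (U - insert t L)" "g ` (U - insert t L) \<subseteq> V"
      "\<And>y z. y \<in> U - insert t L \<Longrightarrow> z \<in> U - insert t L \<Longrightarrow> E y z \<Longrightarrow> \<not> B (g y) (g z)"
    and t: "t \<in> U" "t \<notin> L" and L: "finite L" "L \<subseteq> U" "\<And>y z. y \<in> L \<Longrightarrow> z \<in> U \<Longrightarrow> E y z \<Longrightarrow> z = t"
    and x: "x \<in> V" "x \<notin> g ` (U - insert t L)"
      "\<And>s. s \<in> U - insert t L \<Longrightarrow> E t s \<Longrightarrow> \<not> B (g s) x"
    and D: "D \<subseteq> V" "x \<notin> D" "D \<inter> g ` (U - insert t L) = {}" "card L \<le> card D" "finite D"
      "\<And>y. y \<in> D \<Longrightarrow> \<not> B x y"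
    and sym: "symp B" "symp E" and irr: "irreflp E"
  shows "embeds_off U E V B"
proof -
  let ?R = "U - insert t L"
  obtain h where h: "inj_on h L" "h ` L \<subseteq> D" using card_le_inj[OF L(1) D(5,4)] by blast
  define f where "f z = (if z = t then x else if z \<in> L then h z else g z)" for z
  have ft: "f t = x" and fL: "z \<in> L \<Longrightarrow> f z = h z" and fR: "z \<in> ?R \<Longrightarrow> f z = g z" for z
    using t(2) by (auto simp: f_def)
  have U: "U = insert t (L \<union> ?R)" using t L by blast
  have B: "B a b \<longleftrightarrow> B b a" for a b using sym(1) by (auto dest: sympD)
  have E: "E a b \<longleftrightarrow> E b a" for a b using sym(2) by (auto dest: sympD)
  have Lt: "\<not> E y z" if "y \<in> L" "z \<in> U" "z \<noteq> t" for y z using L(3) that by blast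
  have xL: "\<not> B x (f z)" if "z \<in> L" for z using that fL h(2) D(6) by auto
  have xR: "\<not> B x (f z)" if "z \<in> ?R" "E t z" for z using x(3)[OF that] fR[OF that(1)] B by simp
  show ?thesis
  proof (rule embeds_offI)
    have fL': "f ` L \<subseteq> D" using fL h(2) by auto
    have fR': "f ` ?R = g ` ?R" using fR by (rule image_cong[OF refl])
    have "inj_on f L" using h(1) fL by (simp add: inj_on_def)
    moreover have "inj_on f ?R" using g(1) fR by (simp add: inj_on_def)
    moreover have "f ` L \<inter> f ` ?R = {}" using fL' fR' D(3) by auto
    ultimately have "inj_on f (L \<union> ?R)" unfolding inj_on_Un by blast
    moreover have "f t \<notin> f ` (L \<union> ?R)" using ft fL' fR' D(2) x(2) by auto
    ultimately have "inj_on f (insert t (L \<union> ?R))" by auto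
    then show "inj_on f U" using U by simp
    have "f ` L \<subseteq> V" "f ` ?R \<subseteq> V" using fL' fR' D(1) g(2) by auto
    then have "f ` insert t (L \<union> ?R) \<subseteq> V" unfolding image_insert image_Un using ft x(1) by simp
    then show "f ` U \<subseteq> V" using U by simp
    fix y z assume yz: "y \<in> U" "z \<in> U" "E y z"
    then have yz_ne: "y \<noteq> z" using irr by (auto simp: irreflp_def)
    consider (1) "y = t" "z \<in> L" | (2) "y = t" "z \<in> ?R" | (3) "z = t" "y \<in> L"
      | (4) "z = t" "y \<in> ?R" | (5) "y \<in> ?R" "z \<in> ?R" | (6) "y \<in> L" "z \<noteq> t"
      | (7) "z \<in> L" "y \<noteq> t"
    proof -
      have "y = t \<or> y \<in> L \<or> y \<in> ?R" "z = t \<or> z \<in> L \<or> z \<in> ?R" using yz(1,2) by auto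
      then show ?thesis using that yz_ne by metis
    qed
    then show "\<not> B (f y) (f z)"
    proof cases
      case 1
      then show ?thesis using xL ft by simp
    next
      case 2
      then show ?thesis using xR ft yz(3) by simp
    next
      case 3
      then show ?thesis using xL ft B by simp
    next
      case 4
      then show ?thesis using xR ft B E yz(3) by simp
    next
      case 5
      then show ?thesis using g(3) fR yz(3) by simp
    next
      case 6
      then show ?thesis using Lt yz by blast
    next
      case 7
      then show ?thesis using Lt[of z y] yz E by blast
    qed
  qed
qed

text \<open>The vertices of degree at least two again span a forest, so one of them,
  \<open>t\<close>, has at most one neighbour among them. All other neighbours of \<open>t\<close>
  are leaves, and there is one because \<open>t\<close> has degree at least two.\<close>

lemma forest_pendant_star:
  assumes "forest U E" "a \<in> U" "b \<in> U" "E a b"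
  obtains t L where "t \<in> U" "L \<subseteq> U" "L \<noteq> {}" "t \<notin> L"
    "\<forall>x\<in>L. E t x \<and> (\<forall>y\<in>U. E x y \<longrightarrow> y = t)" "card {s \<in> U - L. E t s} \<le> 1"
proof -
  have fin: "finite U" and sym: "\<And>x y. E x y \<Longrightarrow> E y x" and irr: "\<And>x. \<not> E x x"
    using assms(1) by (auto simp: forest_def symp_def irreflp_def)
  define S where "S = {x \<in> U. card {u \<in> U. E x u} \<ge> 2}"
  have leaf: "y = t" if "x \<in> U" "x \<notin> S" "t \<in> U" "y \<in> U" "E x t" "E x y" for x y t
  proof (rule ccontr)
    assume "y \<noteq> t"
    then have "card {y, t} = 2" by simp
    moreover have "card {y, t} \<le> card {u \<in> U. E x u}"
      using that fin by (intro card_mono) auto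
    ultimately show False using that unfolding S_def by simp
  qed
  show ?thesis
  proof (cases "S = {}")
    case True
    \<comment> \<open>Every vertex has degree at most one, so \<open>a\<close> and its only
      neighbour form a star by themselves.\<close>
    show ?thesis
    proof (rule that[of a "{u \<in> U. E a u}"])
      have none: "{s \<in> U - {u \<in> U. E a u}. E a s} = {}" by blast
      show "card {s \<in> U - {u \<in> U. E a u}. E a s} \<le> 1" unfolding none by simp
      have "y = a" if "x \<in> {u \<in> U. E a u}" "y \<in> U" "E x y" for x y
        using that True leaf[of x a y] assms(2) sym by blast
      then show "\<forall>x\<in>{u \<in> U. E a u}. E a x \<and> (\<forall>y\<in>U. E x y \<longrightarrow> y = a)" by auto
    qed (use assms irr in auto)
  next
    case False
    moreover have "S \<subseteq> U" unfolding S_def by blast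
    ultimately obtain t where t: "t \<in> S" "card {u \<in> S. E t u} \<le> 1"
      using assms(1) unfolding forest_def by blast
    let ?L = "{u \<in> U - S. E t u}"
    have tU: "t \<in> U" "2 \<le> card {u \<in> U. E t u}" using t(1) unfolding S_def by auto
    have rest: "{s \<in> U - ?L. E t s} = {u \<in> S. E t u}" using \<open>S \<subseteq> U\<close> by blast
    show ?thesis
    proof (rule that[of t ?L])
      show "?L \<noteq> {}"
      proof
        assume "?L = {}"
        then have "{u \<in> U. E t u} = {u \<in> S. E t u}" using \<open>S \<subseteq> U\<close> by blast
        then show False using t(2) tU(2) by simp
      qed
      show "card {s \<in> U - ?L. E t s} \<le> 1" unfolding rest by (rule t(2))
      have "y = t" if "x \<in> ?L" "y \<in> U" "E x y" for x y
        using that leaf[of x t y] tU(1) sym by blast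
      then show "\<forall>x\<in>?L. E t x \<and> (\<forall>y\<in>U. E x y \<longrightarrow> y = t)" by auto
    qed (use tU(1) t(1) in auto)
  qed
qed

section \<open>Red embeddings of a forest that is minimal without one\<close>

text \<open>This is the situation inside the induction on the forest. The forbidden blue cycle is
  hidden in \<open>smaller\<close>: a smaller forest embeds whenever the host loses at most as many
  vertices as the forest, since the size bounds of the induction survive such a step.\<close>

locale minimal_embedding =
  fixes U :: "'a set" and E :: "'a \<Rightarrow> 'a \<Rightarrow> bool" and V :: "'v set" and B :: "'v \<Rightarrow> 'v \<Rightarrow> bool"
  assumes forest: "forest U E" and finite_V: "finite V"
    and symp_B: "symp B" and irreflp_B: "irreflp B"
    and card_V: "card V + 1 \<ge> 2 * card U"
    and not_embeds: "\<not> embeds_off U E V B"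
    and smaller: "\<And>U' V'. U' \<subset> U \<Longrightarrow> V' \<subseteq> V \<Longrightarrow> card V + card U' \<le> card V' + card U \<Longrightarrow>
      embeds_off U' E V' B"
begin

lemma finite_U: "finite U" and symp_E: "symp E" and irreflp_E: "irreflp E"
  using forest by (auto simp: forest_def)

lemma B_sym: "B x y \<longleftrightarrow> B y x" and B_irrefl: "\<not> B x x"
  using symp_B irreflp_B by (auto dest: sympD simp: irreflp_def)

lemma E_sym: "E x y \<longleftrightarrow> E y x" and E_irrefl: "\<not> E x x"
  using symp_E irreflp_E by (auto dest: sympD simp: irreflp_def)

lemma ex_edge: "\<exists>x\<in>U. \<exists>y\<in>U. E x y"
proof (rule ccontr)
  assume none: "\<not> ?thesis"
  have "card U \<le> card V" using card_V by (cases "card U") auto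
  then obtain f where "inj_on f U" "f ` U \<subseteq> V" using card_le_inj[OF finite_U finite_V] by blast
  then have "embeds_off U E V B" using none by (intro embeds_offI) auto
  then show False using not_embeds by blast
qed

lemma card_U_ge_2: "card U \<ge> 2"
proof -
  obtain x y where "x \<in> U" "y \<in> U" "E x y" using ex_edge by blast
  then have "{x, y} \<subseteq> U" "x \<noteq> y" using E_irrefl by auto
  then show ?thesis using card_mono[OF finite_U, of "{x, y}"] by simp
qed

lemma card_U_less: "card U < card V" using card_V card_U_ge_2 by linarith

definition red :: "'v \<Rightarrow> 'v set" where "red x = {y \<in> V. y \<noteq> x \<and> \<not> B x y}"
definition blue :: "'v \<Rightarrow> 'v set" where "blue x = {y \<in> V. B x y}"

lemma red_blue: "x \<in> V \<Longrightarrow> card (red x) + card (blue x) + 1 = card V"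
proof -
  assume "x \<in> V"
  then have "V = insert x (red x \<union> blue x)" using B_irrefl by (auto simp: red_def blue_def)
  moreover have "x \<notin> red x \<union> blue x" "red x \<inter> blue x = {}" "finite (red x)" "finite (blue x)"
    using B_irrefl finite_V by (auto simp: red_def blue_def)
  ultimately show ?thesis by (metis Suc_eq_plus1 card_Un_disjoint card_insert_disjoint finite_UnI)
qed

text \<open>
  Remove a pendant star with centre \<open>t\<close> and leaves \<open>L\<close>, whose only further neighbour is some \<open>s\<close>, and
  embed the rest by induction in the complement of a set \<open>W\<close> of \<open>card L + 1\<close> vertices. Unless the image
  of \<open>s\<close> is blue to both \<open>u\<close> and \<open>v\<close>, one of them can host \<open>t\<close>: the leaves at \<open>v\<close> are reserved in
  \<open>W\<close>, and \<open>u\<close> has enough red neighbours anyway.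
\<close>

lemma common_blue_neighbour_aux:
  assumes uv: "u \<in> V" "v \<in> V" "u \<noteq> v" "\<not> B u v"
    and u: "card U \<le> card (red u) + 1"
  shows "\<exists>q\<in>V. B u q \<and> B v q"
proof (rule ccontr)
  assume no: "\<not> ?thesis"
  obtain a b where ab: "a \<in> U" "b \<in> U" "E a b" using ex_edge by blast
  obtain t L where t: "t \<in> U" and L: "L \<subseteq> U" "L \<noteq> {}" and tL: "t \<notin> L"
    and star: "\<forall>x\<in>L. E t x \<and> (\<forall>y\<in>U. E x y \<longrightarrow> y = t)"
    and nbr: "card {s \<in> U - L. E t s} \<le> 1"
    by (rule forest_pendant_star[OF forest ab])
  have leaf: "y = t" if "x \<in> L" "y \<in> U" "E x y" for x y using star that by blast
  define R where "R = U - insert t L"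
  have finL: "finite L" using L(1) finite_U finite_subset by blast
  have "card (insert t L) = Suc (card L)" using finL tL by simp
  then have cardR: "card R + card L + 1 = card U"
    using t L(1) finL card_mono[OF finite_U, of "insert t L"] unfolding R_def
    by (simp add: card_Diff_subset)
  have R: "R \<subset> U" using t unfolding R_def by blast
  have dL: "card L \<ge> 1" using L(2) finL by (simp add: Suc_leI card_gt_0_iff)
  have nbr_unique: "s = s'" if "s \<in> R" "E t s" "s' \<in> R" "E t s'" for s s'
  proof (rule ccontr)
    assume "s \<noteq> s'"
    then have "card {s, s'} = 2" by simp
    moreover have "{s, s'} \<subseteq> {s \<in> U - L. E t s}" using that unfolding R_def by blast
    ultimately show False using nbr card_mono[of "{s \<in> U - L. E t s}" "{s, s'}"] finite_U by simp
  qed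
  \<comment> \<open>Removing \<open>t\<close> and \<open>L\<close> costs the forest
    \<open>card L + 1\<close> vertices, so \<open>smaller\<close> tolerates the removal of a
    \<open>W\<close> of that size. What remains is to find, for every embedding \<open>g\<close> of
    \<open>R\<close>, a place \<open>x\<close> for \<open>t\<close> and places \<open>D\<close> for
    the leaves.\<close>
  have place: False if W: "W \<subseteq> V" "card W \<le> card L + 1"
    and step: "\<And>g. inj_on g R \<Longrightarrow> g ` R \<subseteq> V - W \<Longrightarrow>
      \<exists>x D. x \<in> V \<and> x \<notin> g ` R \<and> (\<forall>s\<in>R. E t s \<longrightarrow> \<not> B (g s) x) \<and> D \<subseteq> red x \<and>
        D \<inter> g ` R = {} \<and> card L \<le> card D" for W
  proof -
    have "card (V - W) = card V - card W" using W(1) finite_V by (simp add: card_Diff_subset finite_subset)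
    then have "card V + card R \<le> card (V - W) + card U" using W(2) cardR by linarith
    then have "embeds_off R E (V - W) B" using smaller[OF R, of "V - W"] by blast
    then obtain g where g: "inj_on g R" "g ` R \<subseteq> V - W" "\<forall>y\<in>R. \<forall>z\<in>R. E y z \<longrightarrow> \<not> B (g y) (g z)"
      unfolding embeds_off_def by blast
    obtain x D where "x \<in> V \<and> x \<notin> g ` R \<and> (\<forall>s\<in>R. E t s \<longrightarrow> \<not> B (g s) x) \<and>
        D \<subseteq> red x \<and> D \<inter> g ` R = {} \<and> card L \<le> card D"
      using step[OF g(1,2)] by (elim exE)
    then have xD: "x \<in> V" "x \<notin> g ` R" "\<And>s. s \<in> R \<Longrightarrow> E t s \<Longrightarrow> \<not> B (g s) x"
      "D \<subseteq> red x" "D \<inter> g ` R = {}" "card L \<le> card D"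
      by simp_all
    have D: "D \<subseteq> V" "x \<notin> D" "\<And>y. y \<in> D \<Longrightarrow> \<not> B x y"
      using xD(4) unfolding red_def by auto
    have finD: "finite D" using D(1) finite_V finite_subset by blast
    have "embeds_off U E V B"
    proof (rule embeds_off_add_star[where U = U and g = g and t = t and L = L and x = x and D = D, folded R_def])
      show "g ` R \<subseteq> V" using g(2) by blast
      show "\<And>y z. y \<in> R \<Longrightarrow> z \<in> R \<Longrightarrow> E y z \<Longrightarrow> \<not> B (g y) (g z)" using g(3) by blast
    qed (fact g(1) t tL finL L(1) leaf xD D finD symp_B symp_E irreflp_E)+
    then show False using not_embeds by blast
  qed
  have cardg: "card (g ` R) = card R" if "inj_on g R" for g :: "'a \<Rightarrow> 'v" using that by (rule card_image)
  have finR: "finite R" using R finite_U finite_subset by blast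
  have fin_red: "finite (red x)" for x using finite_V by (simp add: red_def)
  \<comment> \<open>By assumption \<open>red u\<close> has at least \<open>card R + card L\<close>
    elements, so \<open>card L\<close> of them avoid the image of \<open>R\<close>.\<close>
  have at_u: "card L \<le> card (red u - g ` R)" if "inj_on g R" for g :: "'a \<Rightarrow> 'v"
  proof -
    have "card (red u) - card (g ` R) \<le> card (red u - g ` R)" using finR by (intro diff_card_le_card_Diff) simp
    then show ?thesis using u cardR cardg[OF that] by linarith
  qed
  show False
  proof (cases "card L \<le> card (red v)")
    case True
    have "u \<in> red v" using uv B_sym by (auto simp: red_def)
    then have "card (red v - {u}) = card (red v) - 1" by simp
    then have "card L - 1 \<le> card (red v - {u})" using True by linarith
    then obtain D' where D': "D' \<subseteq> red v - {u}" "card D' = card L - 1" by (meson obtain_subset_with_card_n)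
    \<comment> \<open>Reserving \<open>u\<close> among the leaf positions of \<open>v\<close> keeps
      both \<open>u\<close> and \<open>v\<close> available for \<open>t\<close>. If \<open>v\<close>
      takes \<open>t\<close>, then \<open>u\<close> may take a leaf, as the edge between them is
      red.\<close>
    define D where "D = insert u D'"
    have finD': "finite D'" using D'(1) fin_red finite_subset by blast
    have "u \<notin> D'" using D'(1) by blast
    then have "card D = card L" using D'(2) finD' dL unfolding D_def by simp
    then have D: "D \<subseteq> red v" "card D = card L" "u \<in> D"
      using D'(1) \<open>u \<in> red v\<close> unfolding D_def by auto
    have w: "card (insert v D) \<le> card L + 1" using D(2) finD' by (simp add: D_def card_insert_if)
    have "insert v D \<subseteq> V" using D(1) uv unfolding red_def by blast
    from place[OF this w] show False
    proof
      fix g :: "'a \<Rightarrow> 'v" assume g: "inj_on g R" "g ` R \<subseteq> V - insert v D"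
      show "\<exists>x D. x \<in> V \<and> x \<notin> g ` R \<and> (\<forall>s\<in>R. E t s \<longrightarrow> \<not> B (g s) x) \<and> D \<subseteq> red x \<and>
        D \<inter> g ` R = {} \<and> card L \<le> card D"
      proof (cases "\<forall>s\<in>R. E t s \<longrightarrow> \<not> B (g s) v")
        case True
        then show ?thesis using uv(2) g(2) D by (intro exI[of _ v] exI[of _ D]) auto
      next
        case False
        then obtain s where s: "s \<in> R" "E t s" "B (g s) v" by blast
        have "\<not> B (g s) u"
          using no s g(2) B_sym by blast
        then have "\<forall>s'\<in>R. E t s' \<longrightarrow> \<not> B (g s') u" using nbr_unique s by blast
        then show ?thesis using uv(1) g(2) D(3) at_u[OF g(1)]
          by (intro exI[of _ u] exI[of _ "red u - g ` R"]) auto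
      qed
    qed
  next
    case False
    \<comment> \<open>Without a common blue neighbour, \<open>blue u\<close> is no larger than
      \<open>red v\<close>, which is small in this case. So all of it can be reserved together with
      \<open>u\<close>, and then the whole image of \<open>R\<close> is red to
      \<open>u\<close>.\<close>
    have "blue u \<subseteq> red v - {u}"
      using no uv B_irrefl B_sym unfolding blue_def red_def by blast
    then have "card (blue u) \<le> card (red v - {u})" using fin_red by (intro card_mono) auto
    moreover have "card (red v - {u}) \<le> card (red v)" using fin_red by (intro card_mono) auto
    ultimately have w: "card (insert u (blue u)) \<le> card L + 1"
      using False finite_V by (simp add: card_insert_if blue_def)
    have "insert u (blue u) \<subseteq> V" using uv unfolding blue_def by blast
    from place[OF this w] show False
    proof
      fix g :: "'a \<Rightarrow> 'v" assume g: "inj_on g R" "g ` R \<subseteq> V - insert u (blue u)"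
      have "\<not> B (g s) u" if "s \<in> R" for s using g(2) that B_sym unfolding blue_def by blast
      then show "\<exists>x D. x \<in> V \<and> x \<notin> g ` R \<and> (\<forall>s\<in>R. E t s \<longrightarrow> \<not> B (g s) x) \<and> D \<subseteq> red x \<and>
        D \<inter> g ` R = {} \<and> card L \<le> card D"
        using uv(1) g(2) at_u[OF g(1)] by (intro exI[of _ u] exI[of _ "red u - g ` R"]) auto
    qed
  qed
qed

text \<open>The previous lemma applies if one of the two red degrees is at least
  \<open>card U - 1\<close>. Otherwise both blue degrees are at least
  \<open>card V - card U + 1\<close>, and two disjoint sets of this size do not fit into
  \<open>V - {u, v}\<close>.\<close>

lemma common_blue_neighbour:
  assumes uv: "u \<in> V" "v \<in> V" "u \<noteq> v" "\<not> B u v"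
  shows "\<exists>q\<in>V. B u q \<and> B v q"
proof -
  consider "card U \<le> card (red u) + 1" | "card U \<le> card (red v) + 1"
    | "card (red u) + 2 \<le> card U" "card (red v) + 2 \<le> card U" by linarith
  then show ?thesis
  proof cases
    case 1
    then show ?thesis using common_blue_neighbour_aux uv by blast
  next
    case 2
    moreover have "\<not> B v u" using uv(4) B_sym by simp
    ultimately show ?thesis using common_blue_neighbour_aux[of v u] uv by blast
  next
    case 3
    have sub: "blue u \<union> blue v \<subseteq> V - {u, v}"
      using uv B_irrefl B_sym unfolding blue_def by blast
    have "card (V - {u, v}) + 2 = card V"
      using uv finite_V card_mono[OF finite_V, of "{u, v}"] by (simp add: card_Diff_subset)
    then have "card (blue u \<union> blue v) + 2 \<le> card V"
      using card_mono[OF _ sub] finite_V by simp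
    moreover have "card (red u) + card (blue u) + 1 = card V" "card (red v) + card (blue v) + 1 = card V"
      using red_blue uv by auto
    ultimately have "card (blue u \<union> blue v) < card (blue u) + card (blue v)"
      using 3 card_V by linarith
    moreover have "finite (blue u)" "finite (blue v)" using finite_V by (auto simp: blue_def)
    ultimately have "blue u \<inter> blue v \<noteq> {}" using card_Un_disjoint by fastforce
    then show ?thesis unfolding blue_def by blast
  qed
qed

text \<open>
  Part \<open>J\<close> of a colour class goes to the smaller side. The induction hypothesis for the other side falls
  one vertex short, so \<open>J\<close> contains the only neighbour of some leaf \<open>l\<close>, which can then be placed last.
\<close>

lemma no_spanning_hole:
  assumes M: "M \<subseteq> V" "N \<subseteq> V" "M \<inter> N = {}" "M \<noteq> {}" "N \<noteq> {}" "card V \<le> card M + card N + 1"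
    and hole: "\<And>x y. x \<in> M \<Longrightarrow> y \<in> N \<Longrightarrow> \<not> B x y"
  shows False
  using M hole
proof (induction "card M" "card N" arbitrary: M N rule: linorder_wlog)
  case sym
  then show ?case using B_sym by (metis Int_commute add.commute)
next
  case (le M N)
  have fin: "finite M" "finite N" using le.prems(1,2) finite_V finite_subset by auto
  obtain a b where ab: "a \<in> U" "b \<in> U" "E a b" using ex_edge by blast
  obtain t L where t: "t \<in> U" and L: "L \<subseteq> U" "L \<noteq> {}"
    and star: "\<forall>x\<in>L. E t x \<and> (\<forall>y\<in>U. E x y \<longrightarrow> y = t)"
    by (rule forest_pendant_star[OF forest ab])
  have leaf: "y = t" if "x \<in> L" "y \<in> U" "E x y" for x y using star that by blast
  obtain l where l: "l \<in> L" "l \<in> U" "E t l" using L star by blast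
  obtain col :: "'a \<Rightarrow> bool" where col: "\<And>x y. x \<in> U \<Longrightarrow> y \<in> U \<Longrightarrow> E x y \<Longrightarrow> col x \<noteq> col y"
    using forest_two_colouring[OF forest] by blast
  define P where "P = {x \<in> U. col x = col t}"
  have P: "P \<subseteq> U" "t \<in> P" "l \<notin> P" using t l col unfolding P_def by auto
  have finP: "finite P" using P(1) finite_U finite_subset by blast
  have indep: "\<not> E x y" if "x \<in> P" "y \<in> P" for x y using that col unfolding P_def by blast
  have indep': "\<not> E x y" if "x \<in> U - P" "y \<in> U - P" for x y using that col unfolding P_def by blast
  show False
  proof (cases "card M \<le> card P")
    case False
    have "card (U - P) + 1 \<le> card U"
      using P finite_U finP by (metis Suc_eq_plus1 Suc_leI card_seteq Diff_subset DiffD2 not_less subsetD)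
    \<comment> \<open>As the larger side, \<open>N\<close> has at least \<open>card U - 1\<close>
      vertices, while \<open>U - P\<close> misses \<open>t\<close>.\<close>
    then have "card (U - P) \<le> card N" using le card_V by linarith
    then have "embeds_off (P \<union> (U - P)) E V B"
      using False le.prems finP finite_U fin indep indep' symp_B
      by (intro embeds_off_bipartite[where M = M and N = N]) auto
    moreover have "P \<union> (U - P) = U" using P(1) by blast
    ultimately show False using not_embeds by simp
  next
    case True
    have "card M \<ge> 1" using le.prems(4) fin by (simp add: Suc_leI card_gt_0_iff)
    have "card M - 1 \<le> card (P - {t})" using True P(2) by simp
    then obtain J' where J': "J' \<subseteq> P - {t}" "card J' = card M - 1" by (meson obtain_subset_with_card_n)
    define J where "J = insert t J'"
    have finJ: "finite J'" using J'(1) finP finite_subset by blast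
    have "t \<notin> J'" using J'(1) by blast
    then have "card J = card M" using J'(2) finJ \<open>card M \<ge> 1\<close> unfolding J_def by simp
    then have J: "J \<subseteq> P" "card J = card M" "t \<in> J" "finite J"
      using J'(1) P(2) finJ unfolding J_def by auto
    \<comment> \<open>Up to \<open>card M + 1\<close> vertices lie outside \<open>N\<close>, so
      \<open>smaller\<close> requires one more vertex to be removed besides
      \<open>J\<close>.\<close>
    define R where "R = U - insert l J"
    have lJ: "l \<notin> J" using J(1) P(3) by blast
    have "insert l J \<subseteq> U" using J(1) P(1) l(2) by blast
    then have "card R + card (insert l J) = card U"
      unfolding R_def using finite_U J(4) by (metis card_Diff_subset card_mono finite_insert le_add_diff_inverse2)
    then have cardR: "card R + card M + 1 = card U" using lJ J by simp
    have "R \<subset> U" using l unfolding R_def by blast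
    moreover have "card V + card R \<le> card N + card U" using le.prems(6) cardR by linarith
    ultimately have "embeds_off R E N B" using smaller le.prems(2) by blast
    then obtain g where g: "inj_on g R" "g ` R \<subseteq> N" "\<forall>y\<in>R. \<forall>z\<in>R. E y z \<longrightarrow> \<not> B (g y) (g z)"
      unfolding embeds_off_def by blast
    obtain h where h: "inj_on h J" "h ` J \<subseteq> M" using card_le_inj[OF J(4) fin(1)] J(2) by auto
    \<comment> \<open>Since \<open>card U < card V\<close>, the image of \<open>R\<close> leaves a
      vertex of \<open>N\<close> free for \<open>l\<close>.\<close>
    have "card (g ` R) < card N" using card_image[OF g(1)] cardR le.prems(6) card_U_less by linarith
    then have "\<not> N \<subseteq> g ` R"
      using R_def finite_U by (meson card_mono finite_Diff finite_imageI leD)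
    then obtain y where y: "y \<in> N" "y \<notin> g ` R" by blast
    define f where "f z = (if z = l then y else if z \<in> J then h z else g z)" for z
    have fl: "f l = y" and fJ: "\<And>z. z \<in> J \<Longrightarrow> f z = h z" and fR: "\<And>z. z \<in> R \<Longrightarrow> f z = g z"
      using lJ by (auto simp: f_def R_def)
    have U: "U = J \<union> insert l R" using \<open>insert l J \<subseteq> U\<close> unfolding R_def by blast
    have fJM: "f z \<in> M" if "z \<in> J" for z using that fJ h(2) by auto
    have fRN: "f z \<in> N" if "z \<in> insert l R" for z using that fR fl g(2) y(1) by auto
    have "embeds_off U E V B"
    proof (rule embeds_offI)
      have "inj_on f J" using h(1) fJ by (simp add: inj_on_def)
      moreover have "inj_on f R" using g(1) fR by (simp add: inj_on_def)
      moreover have "f ` R = g ` R" using fR by (rule image_cong[OF refl])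
      then have "f l \<notin> f ` R" using y(2) fl by simp
      ultimately have "inj_on f J" "inj_on f (insert l R)" by (auto simp: R_def)
      moreover have "f ` J \<inter> f ` insert l R = {}"
      proof -
        have "f ` J \<subseteq> M" "f ` insert l R \<subseteq> N" using fJM fRN by auto
        then show ?thesis using le.prems(3) by blast
      qed
      then have "f ` (J - insert l R) \<inter> f ` (insert l R - J) = {}" by blast
      ultimately have "inj_on f (J \<union> insert l R)" unfolding inj_on_Un by blast
      then show "inj_on f U" using U by simp
      show "f ` U \<subseteq> V" unfolding U using fJM fRN le.prems(1,2) by auto
      fix a b assume ab: "a \<in> U" "b \<in> U" "E a b"
      \<comment> \<open>The only neighbour of \<open>l\<close> is \<open>t\<close>, which sits on
        the other side; so \<open>l\<close> adds no edge within \<open>N\<close>.\<close>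
      have lR: "\<not> E l z" "\<not> E z l" if "z \<in> insert l R" for z
      proof -
        have "z \<noteq> t" using that J(3) l(3) E_irrefl unfolding R_def by auto
        moreover have "z \<in> U" using that U by blast
        ultimately show "\<not> E l z" using leaf[OF l(1)] by blast
        then show "\<not> E z l" using E_sym by blast
      qed
      consider (1) "a \<in> J" "b \<in> J" | (2) "a \<in> J" "b \<in> insert l R" | (3) "a \<in> insert l R" "b \<in> J"
        | (4) "a \<in> insert l R" "b \<in> insert l R"
        using ab(1,2) U by blast
      then show "\<not> B (f a) (f b)"
      proof cases
        case 1
        then show ?thesis using indep J(1) ab(3) by blast
      next
        case 2
        then show ?thesis using le.prems(7) fJM fRN by blast
      next
        case 3
        then show ?thesis using le.prems(7)[OF fJM fRN] B_sym by blast
      next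
        case 4
        then have "a \<in> R" "b \<in> R" using lR ab(3) by auto
        then show ?thesis using g(3) fR ab(3) by simp
      qed
    qed
    then show False using not_embeds by blast
  qed
qed

end

section \<open>Lengthening an odd cycle\<close>

lemma has_cycle_mono:
  assumes "has_cycle B V k" "V \<subseteq> W"
  shows "has_cycle B W k"
proof -
  obtain c where c: "cyc B V k c" using assms(1) unfolding has_cycle_def by blast
  then have "range c \<subseteq> W" using assms(2) unfolding cyc_def by (meson order_trans)
  then have "cyc B W k c" using c unfolding cyc_def by simp
  then show ?thesis unfolding has_cycle_def by blast
qed

lemma range_cyc: "cyc B V k c \<Longrightarrow> k \<ge> 1 \<Longrightarrow> finite (range c) \<and> card (range c) = k"
proof -
  assume c: "cyc B V k c" and k: "k \<ge> 1"
  have "range c = c ` {..<k}"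
  proof
    show "range c \<subseteq> c ` {..<k}"
    proof
      fix x assume "x \<in> range c"
      then obtain i where "x = c i" by blast
      also have "c i = c (i mod k)" using c unfolding cyc_def by simp
      finally show "x \<in> c ` {..<k}" using k by simp
    qed
  qed auto
  moreover have "inj_on c {..<k}" using c unfolding cyc_def inj_on_def by simp
  ultimately show ?thesis by (simp add: card_image)
qed

text \<open>Let \<open>xs ! t\<close> be joined to \<open>c (f t)\<close>. Among the
  \<open>k + 1\<close> residues of \<open>f t - t\<close> modulo \<open>k\<close> two agree, say for
  \<open>s < t\<close>. Then \<open>c (f t)\<close> lies \<open>t - s\<close> steps after
  \<open>c (f s)\<close>, and the subpath from \<open>xs ! s\<close> to \<open>xs ! t\<close> can be
  used for rerouting.\<close>

lemma path_attached_to_cyc: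
  assumes c: "cyc B V k c" and k: "k \<ge> 1" and B: "symp B"
    and xs: "distinct xs" "set xs \<subseteq> V - range c" "successively B xs" "length xs = Suc k"
    and att: "\<And>x. x \<in> set xs \<Longrightarrow> \<exists>i. B x (c i)"
  shows "has_cycle B V (k + 2)"
proof -
  have "\<forall>t. \<exists>i. t \<le> k \<longrightarrow> B (xs ! t) (c i)" using att xs(4) by (auto simp: less_Suc_eq_le)
  then obtain f where f: "\<And>t. t \<le> k \<Longrightarrow> B (xs ! t) (c (f t))" by metis
  \<comment> \<open>Modulo \<open>k\<close>, the term \<open>(k - 1) * t\<close> is
    \<open>- t\<close>, written without subtracting natural numbers.\<close>
  let ?h = "\<lambda>t. (f t + (k - 1) * t) mod k"
  have "?h ` {..k} \<subseteq> {..<k}" using k by auto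
  then have "card (?h ` {..k}) \<le> k" using card_mono[of "{..<k}"] by fastforce
  then have "\<not> inj_on ?h {..k}" using card_image[of ?h "{..k}"] by auto
  then obtain s t where st: "s < t" "t \<le> k" "?h s = ?h t"
    unfolding inj_on_def by (metis atMost_iff linorder_neqE_nat)
  define j where "j = t - s"
  have j: "j \<ge> 1" "j \<le> k" "t = s + j" using st unfolding j_def by auto
  have "(f s + j) mod k = f t mod k"
  proof -
    have ka: "(k - 1) * a + a = k * a" for a using k by (cases k) auto
    have "(f s + j) mod k = (f s + j + k * s) mod k" by simp
    also have "f s + j + k * s = (f s + (k - 1) * s) + t" using ka[of s] j(3) by simp
    also have "\<dots> mod k = ((f t + (k - 1) * t) + t) mod k" using st(3) by (metis mod_add_left_eq)
    also have "(f t + (k - 1) * t) + t = f t + k * t" using ka[of t] by simp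
    also have "\<dots> mod k = f t mod k" by simp
    finally show ?thesis .
  qed
  then have cft: "c (f s + j) = c (f t)" using c unfolding cyc_def by blast
  define ys where "ys = take (Suc j) (drop s xs)"
  have len: "length ys = Suc j" using xs(4) st j unfolding ys_def by simp
  have sub: "set ys \<subseteq> set xs" unfolding ys_def by (meson order_trans set_drop_subset set_take_subset)
  have nth: "ys ! i = xs ! (s + i)" if "i \<le> j" for i
    using that xs(4) st unfolding ys_def by simp
  show ?thesis
  proof (rule cyc_reroute[OF c _ _ _ _ len j(1,2)])
    show "distinct ys" using xs(1) unfolding ys_def by simp
    show "set ys \<subseteq> V" "set ys \<inter> range c = {}" using sub xs(2) by auto
    show "successively B ys"
      unfolding successively_conv_nth
    proof (intro allI impI)
      fix i assume "Suc i < length ys"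
      then have "Suc i \<le> j" using len by simp
      then have "B (xs ! (s + i)) (xs ! Suc (s + i))"
        using xs(3,4) st j unfolding successively_conv_nth by simp
      then show "B (ys ! i) (ys ! Suc i)" using nth[of i] nth[of "Suc i"] \<open>Suc i \<le> j\<close> by simp
    qed
    have "ys \<noteq> []" using len by auto
    then have "hd ys = xs ! s" "last ys = xs ! t"
      using nth[of 0] nth[of j] len j(3) by (simp_all add: hd_conv_nth last_conv_nth)
    then show "B (c (f s)) (hd ys)" "B (last ys) (c (f s + j))"
      using f[of s] f[of t] st cft sympD[OF B] by auto
  qed
qed

context minimal_embedding
begin

lemma cycle_extension:
  assumes k: "odd k" "k \<ge> 3" and card: "card U + 2 * k \<le> card V + 1" and c: "cyc B V k c"
  shows "has_cycle B V (k + 2)"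
proof (rule ccontr)
  assume no: "\<not> ?thesis"
  have cV: "c i \<in> V" and per: "c (i + k) = c i" for i using c unfolding cyc_def by auto
  define X where "X = V - range c"
  define X0 where "X0 = {x \<in> X. \<forall>i. \<not> B x (c i)}"
  have rc: "finite (range c)" "card (range c) = k" "range c \<subseteq> V"
    using range_cyc[OF c] k(2) cV by auto
  have cardX: "card X + k = card V"
    using rc finite_V card_mono[OF finite_V rc(3)] unfolding X_def by (simp add: card_Diff_subset)
  \<comment> \<open>The path \<open>q\<close>, \<open>w\<close>, \<open>q'\<close> would otherwise
    replace the single vertex \<open>c (i + 1)\<close>.\<close>
  have three: "q = q'"
    if "q \<in> X" "w \<in> X" "q' \<in> X" "w \<noteq> q" "w \<noteq> q'" "B q w" "B w q'" "B (c i) q" "B q' (c (i + 2))"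
    for q w q' i
  proof (rule ccontr)
    assume "q \<noteq> q'"
    then have "has_cycle B V (k + 2)"
      using that k(2) by (intro cyc_reroute[OF c, of "[q, w, q']" 2 i]) (auto simp: X_def)
    then show False using no by blast
  qed
  have "X0 \<noteq> {}"
  proof
    assume X0: "X0 = {}"
    obtain col :: "'a \<Rightarrow> bool" where col: "\<forall>x\<in>U. \<forall>y\<in>U. E x y \<longrightarrow> col x \<noteq> col y"
      using forest_two_colouring[OF forest] by blast
    define P where "P = {x \<in> U. col x}"
    have P: "P \<subseteq> U" "finite P" using finite_U unfolding P_def by auto
    have cardP: "card P + card (U - P) = card U"
      using P finite_U card_mono[OF finite_U P(1)] by (simp add: card_Diff_subset)
    \<comment> \<open>With \<open>X0\<close> empty, every vertex of \<open>X\<close> is attached to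
      the cycle. The size assumption gives \<open>card X + 1 \<ge> card U + k\<close>, just enough
      for a hole matching the two colour classes.\<close>
    have "\<nexists>xs. distinct xs \<and> set xs \<subseteq> X \<and> successively B xs \<and> length xs = Suc k"
      using path_attached_to_cyc[OF c _ symp_B] k(2) no X0 unfolding X_def X0_def by fastforce
    then obtain F W where FW: "F \<subseteq> X" "W \<subseteq> X" "F \<inter> W = {}" "card F = card P"
      "card W = card (U - P)" "\<forall>x\<in>F. \<forall>y\<in>W. \<not> B x y"
      using path_free_imp_hole[of X B k "card P" "card (U - P)"] finite_V symp_B k(2) card cardX cardP
      unfolding X_def by auto
    have "F \<subseteq> V" "W \<subseteq> V" using FW(1,2) unfolding X_def by auto
    moreover from this have "finite F" "finite W" using finite_V finite_subset by auto
    ultimately have "embeds_off (P \<union> (U - P)) E V B"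
      using FW(3-6) P finite_U symp_B col
      by (intro embeds_off_bipartite[where M = F and N = W]) (auto simp: P_def)
    moreover have "P \<union> (U - P) = U" using P(1) by blast
    ultimately show False using not_embeds by simp
  qed
  have hub: "\<exists>p. p \<in> X \<and> B w p \<and> (\<forall>i. B p (c i))" if w: "w \<in> X0" for w
  proof -
    have wX: "w \<in> X" "\<And>i. \<not> B w (c i)" using w unfolding X0_def by auto
    \<comment> \<open>As \<open>w\<close> has no blue neighbour on the cycle, its edge to
      \<open>c i\<close> is red, and a common blue neighbour must lie off the cycle.\<close>
    have "\<exists>q. q \<in> X \<and> B w q \<and> B (c i) q" for i
    proof -
      have "w \<noteq> c i" using wX(1) unfolding X_def by auto
      then obtain q where "q \<in> V" "B w q" "B (c i) q"
        using common_blue_neighbour[of w "c i"] wX cV unfolding X_def by blast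
      moreover from this have "q \<notin> range c" using wX(2) by auto
      ultimately show ?thesis unfolding X_def by blast
    qed
    then obtain Q where Q: "\<And>i. Q i \<in> X" "\<And>i. B w (Q i)" "\<And>i. B (c i) (Q i)" by metis
    have "Q i = Q (i + 2)" for i
    proof (rule three)
      show "w \<noteq> Q i" "w \<noteq> Q (i + 2)" using Q(2) B_irrefl by metis+
      show "B (Q i) w" "B (Q (i + 2)) (c (i + 2))" using Q(2,3) B_sym by blast+
    qed (use Q wX in auto)
    then have ev: "Q (2 * i) = Q 0" for i by (induction i) auto
    have "B (Q 0) (c i)" for i
    proof (cases "even i")
      case True
      then show ?thesis using ev[of "i div 2"] Q(3)[of i] B_sym by simp
    next
      case False
      \<comment> \<open>For odd \<open>i\<close> the index \<open>i + k\<close> is even and denotes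
        the same cycle vertex; here the odd length enters.\<close>
      then have "2 * ((i + k) div 2) = i + k" using k(1) by simp
      then show ?thesis using ev[of "(i + k) div 2"] Q(3)[of "i + k"] B_sym per by simp
    qed
    then show ?thesis using Q(1,2) by blast
  qed
  have hub_unique: "p = p'" if p: "p \<in> X" "\<And>i. B p (c i)" and p': "p' \<in> X" "\<And>i. B p' (c i)" for p p'
  proof (rule ccontr)
    assume "p \<noteq> p'"
    \<comment> \<open>Two distinct hubs could both be inserted into the cycle, one on each side of
      \<open>c 1\<close>.\<close>
    let ?ys = "p # c 1 # p' # map c [2..<Suc k]"
    have upt: "[1..<Suc k] = 1 # [2..<Suc k]" "[2..<Suc k] = 2 # [3..<Suc k]"
      using k(2) by (auto simp: upt_conv_Cons numeral_eq_Suc)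
    have "distinct (map c [1..<Suc k])" by (rule distinct_map_cyc_upt[OF c]) simp
    then have "distinct (c 1 # map c [2..<Suc k])" by (simp only: upt(1) list.map)
    then have "c 1 \<notin> set (map c [2..<Suc k])" "distinct (map c [2..<Suc k])"
      unfolding distinct.simps by blast+
    then have "distinct ?ys" using \<open>p \<noteq> p'\<close> p(1) p'(1) unfolding X_def by auto
    moreover have "successively B (map c [2..<Suc k])"
      using c unfolding cyc_def by (intro successively_map_upt) simp
    then have "successively B ?ys"
      using p(2) p'(2) B_sym unfolding upt(2) by (simp add: successively_Cons)
    moreover have "last ?ys = c k" using k(2) by simp
    moreover have "set ?ys \<subseteq> V" using p(1) p'(1) cV unfolding X_def by auto
    ultimately have "has_cycle B V (length ?ys)"
    proof (intro has_cycle_list)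
      assume "last ?ys = c k"
      then show "B (last ?ys) (hd ?ys)" using p(2) B_sym by (simp only: list.sel)
    qed simp_all
    moreover have "length ?ys = k + 2" using k(2) by simp
    ultimately show False using no by simp
  qed
  obtain w0 where "w0 \<in> X0" using \<open>X0 \<noteq> {}\<close> by blast
  then obtain p where p: "p \<in> X" "\<And>i. B p (c i)" using hub by blast
  have wp: "B w p" if w: "w \<in> X0" for w
    using hub[OF w] hub_unique p by blast
  have "p \<notin> X0" using p(2) unfolding X0_def by blast
  show False
  \<comment> \<open>The hub \<open>p\<close> is the one vertex that the two sides may leave
    out.\<close>
  proof (rule no_spanning_hole[of X0 "V - X0 - {p}"])
    show "X0 \<subseteq> V" unfolding X0_def X_def by blast
    then show "card V \<le> card X0 + card (V - X0 - {p}) + 1"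
      using finite_V \<open>p \<notin> X0\<close> p(1) card_mono[OF finite_V \<open>X0 \<subseteq> V\<close>]
      by (simp add: card_Diff_subset finite_subset X_def)
    have "c 0 \<in> V - X0 - {p}" using cV p(1) unfolding X0_def X_def by auto
    then show "V - X0 - {p} \<noteq> {}" by blast
    fix w y assume w: "w \<in> X0" and y: "y \<in> V - X0 - {p}"
    have wX: "w \<in> X" "\<And>i. \<not> B w (c i)" using w unfolding X0_def by auto
    show "\<not> B w y"
    proof
      assume wy: "B w y"
      have "y \<in> X" using wy wX(2) y unfolding X_def by auto
      moreover from this obtain i where "B y (c i)" using y unfolding X0_def by blast
      \<comment> \<open>As \<open>p\<close> is blue to the whole cycle, in particular to
        \<open>c (i + 2)\<close>, the path \<open>y\<close>, \<open>w\<close>, \<open>p\<close>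
        falls under \<open>three\<close>.\<close>
      ultimately have "y = p"
        using three[of y w p i] wX(1) p wy wp[OF w] B_sym B_irrefl by metis
      then show False using y by blast
    qed
  qed (use \<open>X0 \<noteq> {}\<close> in auto)
qed

end

section \<open>Triangles, and the double induction\<close>

lemma embeds_or_odd_cycle_base:
  assumes "finite V" "symp B" "irreflp B" "forest U E" "card V + 1 \<ge> 2 * card U" "card V \<ge> card U + 1"
  shows "embeds_off U E V B \<or> has_cycle B V 3"
  using assms(4-6)
proof (induction "card U" arbitrary: U)
  case 0
  then have "U = {}" by (simp add: forest_def)
  then show ?case by (simp add: embeds_off_def)
next
  case (Suc n)
  have finU: "finite U" and sE: "\<And>x y. E x y \<Longrightarrow> E y x" and iE: "\<And>x. \<not> E x x" "irreflp E"
    using Suc.prems(1) by (auto simp: forest_def symp_def irreflp_def)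
  have sB: "\<And>x y. B x y \<Longrightarrow> B y x" and iB: "\<And>x. \<not> B x x"
    using assms(2,3) by (auto simp: symp_def irreflp_def)
  have "U \<noteq> {}" using Suc.hyps(2) by auto
  then obtain v where v: "v \<in> U" "card {u \<in> U. E v u} \<le> 1"
    using Suc.prems(1) unfolding forest_def by blast
  have n: "card (U - {v}) = n" using Suc.hyps(2) v(1) finU by simp
  have "forest (U - {v}) E" using Suc.prems(1) by (rule forest_subset) blast
  then have "embeds_off (U - {v}) E V B \<or> has_cycle B V 3"
    using Suc.hyps n Suc.prems by (intro Suc.hyps(1)) auto
  then show ?case
  proof
    assume "embeds_off (U - {v}) E V B"
    then obtain g where g: "inj_on g (U - {v})" "g ` (U - {v}) \<subseteq> V"
      "\<forall>x\<in>U - {v}. \<forall>y\<in>U - {v}. E x y \<longrightarrow> \<not> B (g x) (g y)"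
      unfolding embeds_off_def by blast
    define Y where "Y = V - g ` (U - {v})"
    have "card (g ` (U - {v})) = n" using card_image[OF g(1)] n by simp
    then have cardY: "card Y + n = card V"
      using g(2) assms(1) card_mono[OF assms(1) g(2)] unfolding Y_def
      by (simp add: card_Diff_subset finU)
    have finY: "finite Y" using assms(1) unfolding Y_def by simp
    have extend: "embeds_off U E V B" if y: "y \<in> Y" "\<And>u. u \<in> U \<Longrightarrow> E v u \<Longrightarrow> \<not> B (g u) y" for y
    proof (rule embeds_offI[where f = "g(v := y)"])
      show "inj_on (g(v := y)) U" using g(1) y(1) unfolding Y_def inj_on_def by (auto simp: image_iff)
      show "g(v := y) ` U \<subseteq> V" using g(2) y(1) unfolding Y_def by auto
      fix a b assume ab: "a \<in> U" "b \<in> U" "E a b"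
      then consider (1) "a = v" "b \<noteq> v" | (2) "b = v" "a \<noteq> v" | (3) "a \<noteq> v" "b \<noteq> v"
        using iE by blast
      then show "\<not> B ((g(v := y)) a) ((g(v := y)) b)"
      proof cases
        case 1
        then show ?thesis using y(2)[of b] ab sB[of y "g b"] by auto
      next
        case 2
        then show ?thesis using y(2)[of a] ab sE[of a b] by auto
      next
        case 3
        then show ?thesis using g(3) ab by simp
      qed
    qed
    show ?thesis
    proof (cases "{u \<in> U. E v u} = {}")
      case True
      have "Y \<noteq> {}" using cardY Suc.prems(3) Suc.hyps(2) by auto
      then show ?thesis using extend True by blast
    next
      case False
      then have "card {u \<in> U. E v u} > 0" using finU by (simp add: card_gt_0_iff)
      then have "card {u \<in> U. E v u} = 1" using v(2) by linarith
      then obtain t where t: "{u \<in> U. E v u} = {t}" using card_1_singletonE by blast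
      then have tv: "t \<in> U" "t \<noteq> v" using iE(1) by auto
      then have gt: "g t \<in> V" using g(2) by auto
      show ?thesis
      proof (cases "\<exists>y\<in>Y. \<not> B (g t) y")
        case True
        then obtain y where y: "y \<in> Y" "\<not> B (g t) y" by blast
        have "u = t" if "u \<in> U" "E v u" for u using t that by blast
        then have "embeds_off U E V B" using y by (intro extend[OF y(1)]) auto
        then show ?thesis ..
      next
        case blue: False
        show ?thesis
        proof (cases "\<exists>x\<in>Y. \<exists>y\<in>Y. B x y")
          case True
          then obtain x y where xy: "x \<in> Y" "y \<in> Y" "B x y" by blast
          then have "B (g t) x" "B y (g t)" using blue sB by auto
          then have "has_cycle B V (length [g t, x, y])"
            using xy gt iB by (intro has_cycle_list) (auto simp: Y_def)
          then show ?thesis by (simp add: numeral_3_eq_3)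
        next
          case False
          \<comment> \<open>The image uses only \<open>card U - 1\<close> of at least
            \<open>2 * card U - 1\<close> vertices, so the clique \<open>Y\<close> hosts the whole
            forest afresh.\<close>
          have "card U \<le> card Y" using cardY Suc.prems(2) Suc.hyps(2) by linarith
          then have "embeds_off U E Y B"
            using False finU finY iE(2) by (intro embeds_off_edgeless) auto
          then show ?thesis unfolding embeds_off_def Y_def by blast
        qed
      qed
    qed
  qed simp
qed

theorem embeds_or_odd_cycle:
  assumes B: "symp B" "irreflp B" and k: "odd k"
    and UV: "finite V" "forest U E" "card V + 1 \<ge> 2 * card U" "card V + 1 \<ge> card U + 2 * k"
  shows "embeds_off U E V B \<or> has_cycle B V (k + 2)"
proof -
  obtain j where j: "k = 2 * j + 1" using k by (elim oddE)
  show ?thesis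
    using UV unfolding j
  proof (induction j arbitrary: U V)
    case 0
    then show ?case using embeds_or_odd_cycle_base[of V B U E] B by (simp add: numeral_3_eq_3)
  next
    case (Suc j)
    note outer = Suc.IH
    show ?case
      using Suc.prems
    proof (induction "card U" arbitrary: U V rule: less_induct)
      case less
      show ?case
      proof (rule ccontr)
        assume no: "\<not> ?case"
        have finU: "finite U" using less.prems(2) by (simp add: forest_def)
        \<comment> \<open>A cycle inside \<open>V'\<close> is also one inside \<open>V\<close>, so
          the inner hypothesis leaves only the embedding. The size bounds persist because the host
          loses at most as many vertices as the forest.\<close>
        interpret minimal_embedding U E V B
        proof
          fix U' V' assume U': "U' \<subset> U" and V': "V' \<subseteq> V" and cards: "card V + card U' \<le> card V' + card U"
          have lt: "card U' < card U" using U' finU by (rule psubset_card_mono[rotated])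
          have "embeds_off U' E V' B \<or> has_cycle B V' (2 * Suc j + 1 + 2)"
          proof (rule less.hyps[OF lt])
            show "finite V'" using V' less.prems(1) by (rule finite_subset)
            show "forest U' E" using less.prems(2) psubset_imp_subset[OF U'] by (rule forest_subset)
          qed (use less.prems(3,4) cards lt in linarith)+
          then show "embeds_off U' E V' B" using no has_cycle_mono[OF _ V'] by blast
        qed (use less.prems(1-3) B no in blast)+
        \<comment> \<open>The outer hypothesis yields the blue cycle that is shorter by two, to be
          lengthened below.\<close>
        have "embeds_off U E V B \<or> has_cycle B V (2 * j + 1 + 2)"
        proof (rule outer)
          show "finite V" "forest U E" "card V + 1 \<ge> 2 * card U" using less.prems(1-3) by blast+
          show "card V + 1 \<ge> card U + 2 * (2 * j + 1)" using less.prems(4) by simp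
        qed
        then obtain c where "cyc B V (2 * j + 1 + 2) c" using not_embeds unfolding has_cycle_def by blast
        then have "has_cycle B V (2 * j + 1 + 2 + 2)"
          using less.prems(4) by (intro cycle_extension) simp_all
        then show False using no by simp
      qed
    qed
  qed
qed

section \<open>The Ramsey number\<close>

lemma simple_graph_edgeD:
  assumes "simple_graph G" "e \<in> edges G"
  shows "e \<subseteq> verts G" "card e = 2"
  using assms unfolding simple_graph_def nsets_def by auto

lemma simple_graph_edge_neq: "simple_graph G \<Longrightarrow> {x, y} \<in> edges G \<Longrightarrow> x \<noteq> y"
  using simple_graph_edgeD(2) by fastforce

lemma has_cycle_imp_contains_copy:
  assumes G: "simple_graph G" and m: "m \<ge> 3"
    and "has_cycle (\<lambda>x y. {x, y} \<in> edges G) (verts G) m"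
  shows "contains_copy G (cycle_graph m)"
proof -
  obtain c where c: "cyc (\<lambda>x y. {x, y} \<in> edges G) (verts G) m c"
    using assms(3) unfolding has_cycle_def by blast
  have mod: "c (Suc i mod m) = c (Suc i)" for i using c unfolding cyc_def by simp
  have inj: "inj_on c {..<m}" using c unfolding cyc_def inj_on_def by simp
  define H where "H = \<lparr>verts = c ` {..<m}, edges = {{c i, c (Suc i mod m)} | i. i < m}\<rparr>"
  have "{c i, c (Suc i)} \<in> edges G" for i using c unfolding cyc_def by simp
  then have edges: "edges H \<subseteq> edges G" using mod unfolding H_def by auto
  have lt: "Suc i mod m < m" for i using m by simp
  have "edges H \<subseteq> [verts H]\<^bsup>2\<^esup>"
  proof
    fix e assume e: "e \<in> edges H"
    then have "card e = 2" using edges simple_graph_edgeD(2)[OF G] by blast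
    moreover have "e \<subseteq> verts H" using e lt unfolding H_def by auto
    ultimately show "e \<in> [verts H]\<^bsup>2\<^esup>" unfolding nsets_def by (simp add: card_ge_0_finite)
  qed
  moreover have "verts H \<subseteq> verts G" using c unfolding H_def cyc_def by auto
  ultimately have "subgraph H G"
    using edges unfolding subgraph_def simple_graph_def by (simp add: H_def)
  moreover have "isomorphic (cycle_graph m) H"
    unfolding isomorphic_def
  proof (intro exI[of _ c] conjI ballI)
    show "bij_betw c (verts (cycle_graph m)) (verts H)"
      using inj unfolding bij_betw_def H_def cycle_graph_def by simp
    fix u v assume uv: "u \<in> verts (cycle_graph m)" "v \<in> verts (cycle_graph m)"
    have eq: "{c u, c v} = {c i, c (Suc i mod m)} \<longleftrightarrow> {u, v} = {i, Suc i mod m}" if "i < m" for i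
      using inj_on_image_eq_iff[OF inj, of "{u, v}" "{i, Suc i mod m}"] uv that lt
      unfolding cycle_graph_def by simp
    show "{u, v} \<in> edges (cycle_graph m) \<longleftrightarrow> {c u, c v} \<in> edges H"
      unfolding H_def cycle_graph_def using eq by auto
  qed
  ultimately show ?thesis unfolding contains_copy_def by blast
qed

lemma embeds_off_imp_contains_copy:
  assumes T: "simple_graph T" and G: "simple_graph G"
    and emb: "embeds_off (verts T) (\<lambda>x y. {x, y} \<in> edges T) (verts G) B"
    and non_B: "\<And>x y. x \<in> verts G \<Longrightarrow> y \<in> verts G \<Longrightarrow> x \<noteq> y \<Longrightarrow> \<not> B x y \<Longrightarrow> {x, y} \<in> edges G"
  shows "contains_copy G T"
proof -
  obtain f where inj: "inj_on f (verts T)" and f: "f ` verts T \<subseteq> verts G"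
    and edge: "\<forall>x\<in>verts T. \<forall>y\<in>verts T. {x, y} \<in> edges T \<longrightarrow> \<not> B (f x) (f y)"
    using emb unfolding embeds_off_def by blast
  define H where "H = \<lparr>verts = f ` verts T, edges = (`) f ` edges T\<rparr>"
  have image_edge: "f ` e \<in> edges G" if eT: "e \<in> edges T" for e
  proof -
    obtain x y where e: "e = {x, y}" "x \<noteq> y"
      using simple_graph_edgeD(2)[OF T eT] unfolding card_2_iff by blast
    then have xy: "x \<in> verts T" "y \<in> verts T" using simple_graph_edgeD(1)[OF T eT] by auto
    then have "f x \<noteq> f y" using inj e(2) by (simp add: inj_on_eq_iff)
    then have "{f x, f y} \<in> edges G" using non_B f edge xy eT e(1) by blast
    then show ?thesis using e(1) by simp
  qed
  have "edges H \<subseteq> [verts H]\<^bsup>2\<^esup>"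
  proof
    fix e assume e: "e \<in> edges H"
    then have "card e = 2"
      using image_edge simple_graph_edgeD(2)[OF G] unfolding H_def by auto
    moreover have "e \<subseteq> verts H"
      using e simple_graph_edgeD(1)[OF T] unfolding H_def by auto
    ultimately show "e \<in> [verts H]\<^bsup>2\<^esup>" unfolding nsets_def by (simp add: card_ge_0_finite)
  qed
  then have "subgraph H G"
    using T f image_edge unfolding subgraph_def simple_graph_def H_def by auto
  moreover have "isomorphic T H"
    unfolding isomorphic_def
  proof (intro exI[of _ f] conjI ballI)
    show "bij_betw f (verts T) (verts H)" using inj unfolding bij_betw_def H_def by simp
    fix u v assume uv: "u \<in> verts T" "v \<in> verts T"
    have eq: "f ` e = f ` {u, v} \<longleftrightarrow> e = {u, v}" if "e \<in> edges T" for e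
      using inj_on_image_eq_iff[OF inj, of e "{u, v}"] uv simple_graph_edgeD(1)[OF T that] by simp
    show "{u, v} \<in> edges T \<longleftrightarrow> {f u, f v} \<in> edges H"
    proof
      assume "{u, v} \<in> edges T"
      then have "f ` {u, v} \<in> edges H" unfolding H_def ugraph.simps by (rule imageI)
      then show "{f u, f v} \<in> edges H" by simp
    next
      assume "{f u, f v} \<in> edges H"
      then obtain e where "e \<in> edges T" "f ` e = f ` {u, v}" unfolding H_def by auto
      then show "{u, v} \<in> edges T" using eq by simp
    qed
  qed
  ultimately show ?thesis unfolding contains_copy_def by blast
qed

text \<open>If every vertex of \<open>S\<close> had two neighbours in \<open>S\<close>, take a
  longest path in \<open>S\<close>: all neighbours of its first vertex lie on it, and one that is
  not the second vertex closes an initial segment to a cycle.\<close>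

lemma acyclic_graph_imp_forest:
  assumes T: "simple_graph T" and acyclic: "acyclic_graph T"
  shows "forest (verts T) (\<lambda>x y. {x, y} \<in> edges T)"
proof -
  let ?E = "\<lambda>x y. {x, y} \<in> edges T"
  have fin: "finite (verts T)" using T by (simp add: simple_graph_def)
  have sym: "?E y x" if "?E x y" for x y using that by (simp add: insert_commute)
  have "\<forall>S\<subseteq>verts T. S \<noteq> {} \<longrightarrow> (\<exists>v\<in>S. card {u \<in> S. ?E v u} \<le> 1)"
  proof (intro allI impI, rule ccontr)
    fix S assume S: "S \<subseteq> verts T" "S \<noteq> {}" and "\<not> (\<exists>v\<in>S. card {u \<in> S. ?E v u} \<le> 1)"
    then have deg: "card {u \<in> S. ?E v u} \<ge> 2" if "v \<in> S" for v using that by fastforce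
    have finS: "finite S" using S(1) fin by (rule finite_subset)
    define path where "path xs \<longleftrightarrow> distinct xs \<and> set xs \<subseteq> S \<and> successively ?E xs" for xs
    obtain x0 where "x0 \<in> S" using S(2) by blast
    then have "path [x0]" by (simp add: path_def)
    moreover have "length xs < Suc (card S)" if "path xs" for xs
      using that finS card_mono[of S "set xs"] distinct_card[of xs] unfolding path_def by simp
    ultimately have "\<exists>xs. path xs \<and> (\<forall>ys. path ys \<longrightarrow> length ys \<le> length xs)"
      by (intro ex_has_greatest_nat[where b = "Suc (card S)"]) auto
    then obtain xs where xs: "path xs" and max: "\<And>ys. path ys \<Longrightarrow> length ys \<le> length xs" by blast
    have ne: "xs \<noteq> []" using max[OF \<open>path [x0]\<close>] by auto
    let ?a = "hd xs"
    have aS: "?a \<in> S" using xs ne unfolding path_def by auto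
    have on_path: "u \<in> set xs" if "u \<in> S" "?E ?a u" for u
    proof (rule ccontr)
      assume "u \<notin> set xs"
      then have "path (u # xs)"
        using xs that sym unfolding path_def by (simp add: successively_Cons)
      then show False using max by fastforce
    qed
    \<comment> \<open>On a path with one vertex \<open>xs ! 1\<close> is an unspecified value. This
      is harmless, as two neighbours never fit into a singleton.\<close>
    have "\<not> {u \<in> S. ?E ?a u} \<subseteq> {xs ! 1}"
    proof
      assume "{u \<in> S. ?E ?a u} \<subseteq> {xs ! 1}"
      then have "card {u \<in> S. ?E ?a u} \<le> card {xs ! 1}" by (intro card_mono) auto
      then show False using deg[OF aS] by simp
    qed
    then obtain u where u: "u \<in> S" "?E ?a u" "u \<noteq> xs ! 1" by blast
    then obtain i where i: "i < length xs" "u = xs ! i" using on_path by (metis in_set_conv_nth)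
    have "i \<noteq> 0" using u(2) i simple_graph_edge_neq[OF T] ne by (metis hd_conv_nth)
    moreover have "i \<noteq> 1" using u(3) i(2) by auto
    ultimately have i2: "i \<ge> 2" by simp
    let ?ys = "take (Suc i) xs"
    have "has_cycle ?E (verts T) (length ?ys)"
    proof (rule has_cycle_list)
      show "distinct ?ys" using xs by (simp add: path_def)
      show "?ys \<noteq> []" using ne by simp
      show "set ?ys \<subseteq> verts T" using xs S(1) set_take_subset[of "Suc i" xs] unfolding path_def by blast
      show "successively ?E ?ys"
        using xs i(1) unfolding path_def by (simp add: successively_conv_nth)
      have "last ?ys = u" using i by (simp add: take_Suc_conv_app_nth)
      moreover have "hd ?ys = ?a" using ne by (simp add: hd_take)
      ultimately show "?E (last ?ys) (hd ?ys)" using u(2) sym by simp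
    qed
    moreover have "length ?ys = Suc i" using i(1) by simp
    ultimately have "contains_copy T (cycle_graph (Suc i))"
      using i2 by (intro has_cycle_imp_contains_copy[OF T]) auto
    then show False using acyclic i2 unfolding acyclic_graph_def by auto
  qed
  moreover have "symp ?E" using sym by (rule sympI)
  moreover have "irreflp ?E" using simple_graph_edge_neq[OF T] by (intro irreflpI) blast
  ultimately show ?thesis using fin unfolding forest_def by (intro conjI)
qed

lemma contains_copyE:
  assumes "contains_copy G H"
  obtains f where "inj_on f (verts H)" "f ` verts H \<subseteq> verts G"
    "\<forall>x\<in>verts H. \<forall>y\<in>verts H. {x, y} \<in> edges H \<longrightarrow> {f x, f y} \<in> edges G"
proof -
  obtain H' f where H': "subgraph H' G" and f: "bij_betw f (verts H) (verts H')"
    "\<forall>u\<in>verts H. \<forall>v\<in>verts H. {u, v} \<in> edges H \<longleftrightarrow> {f u, f v} \<in> edges H'"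
    using assms unfolding contains_copy_def isomorphic_def by blast
  show ?thesis
  proof (rule that)
    show "inj_on f (verts H)" using f(1) by (rule bij_betw_imp_inj_on)
    show "f ` verts H \<subseteq> verts G"
      using bij_betw_imp_surj_on[OF f(1)] H' unfolding subgraph_def by blast
    show "\<forall>x\<in>verts H. \<forall>y\<in>verts H. {x, y} \<in> edges H \<longrightarrow> {f x, f y} \<in> edges G"
      using f(2) H' unfolding subgraph_def by blast
  qed
qed

lemma simple_graph_colour_class:
  "simple_graph (colour_class (complete_graph N) c k)"
  unfolding simple_graph_def colour_class_def complete_graph_def by auto

lemma colour_class_edge_iff:
  "{x, y} \<in> edges (colour_class (complete_graph N) c k) \<longleftrightarrow>
     x \<noteq> y \<and> x < N \<and> y < N \<and> c {x, y} = k"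
  unfolding colour_class_def complete_graph_def nsets_def by (auto simp: card_insert_if)

section \<open>The upper and the lower bound\<close>

lemma tree_or_odd_cycle:
  assumes "odd m" "m \<ge> 3" "tree T" "card (verts T) \<ge> 2 * m - 4"
  shows "contains_copy (colour_class (complete_graph (2 * card (verts T) - 1)) c Red) T \<or>
    contains_copy (colour_class (complete_graph (2 * card (verts T) - 1)) c Blue) (cycle_graph m)"
proof -
  let ?n = "card (verts T)"
  let ?G = "\<lambda>k. colour_class (complete_graph (2 * ?n - 1)) c k"
  let ?B = "\<lambda>x y. {x, y} \<in> edges (?G Blue)"
  have V: "verts (?G k) = {..<2 * ?n - 1}" for k by (simp add: colour_class_def complete_graph_def)
  have T: "simple_graph T" "acyclic_graph T" using assms(3) by (auto simp: tree_def)
  have "embeds_off (verts T) (\<lambda>x y. {x, y} \<in> edges T) {..<2 * ?n - 1} ?B \<or>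
      has_cycle ?B {..<2 * ?n - 1} (m - 2 + 2)"
  proof (rule embeds_or_odd_cycle)
    show "symp ?B" by (rule sympI) (simp only: insert_commute)
    show "irreflp ?B" using simple_graph_edge_neq[OF simple_graph_colour_class] by (intro irreflpI) blast
    show "odd (m - 2)" using assms(1,2) by simp
    show "forest (verts T) (\<lambda>x y. {x, y} \<in> edges T)" by (rule acyclic_graph_imp_forest[OF T])
    show "2 * ?n \<le> card {..<2 * ?n - 1} + 1" by simp
    \<comment> \<open>On \<open>2 * ?n - 1\<close> vertices this is exactly the condition
      \<open>?n \<ge> 2 * m - 4\<close>.\<close>
    show "?n + 2 * (m - 2) \<le> card {..<2 * ?n - 1} + 1" using assms(2,4) unfolding card_lessThan by linarith
  qed simp
  then show ?thesis
  proof
    assume emb: "embeds_off (verts T) (\<lambda>x y. {x, y} \<in> edges T) {..<2 * ?n - 1} ?B"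
    have "contains_copy (?G Red) T"
    proof (rule embeds_off_imp_contains_copy[OF T(1) simple_graph_colour_class])
      show "embeds_off (verts T) (\<lambda>x y. {x, y} \<in> edges T) (verts (?G Red)) ?B"
        using emb by (simp only: V)
      show "{x, y} \<in> edges (?G Red)"
        if "x \<in> verts (?G Red)" "y \<in> verts (?G Red)" "x \<noteq> y" "\<not> ?B x y" for x y
        using that unfolding V colour_class_edge_iff by (cases "c {x, y}") auto
    qed
    then show ?thesis ..
  next
    assume "has_cycle ?B {..<2 * ?n - 1} (m - 2 + 2)"
    moreover have "m - 2 + 2 = m" using assms(2) by simp
    ultimately have "has_cycle ?B (verts (?G Blue)) m" by (simp only: V)
    then have "contains_copy (?G Blue) (cycle_graph m)"
      by (rule has_cycle_imp_contains_copy[OF simple_graph_colour_class assms(2)])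
    then show ?thesis ..
  qed
qed

text \<open>Two disjoint red cliques with at most \<open>card (verts T) - 1\<close> vertices each
  have no room for a connected graph of the size of \<open>T\<close>, and the blue edges between
  them form a bipartite graph, without odd cycles.\<close>

lemma two_red_cliques_colouring:
  assumes "odd m" "simple_graph T" "connected_graph T" "N + 2 \<le> 2 * card (verts T)"
  shows "\<exists>c. \<not> contains_copy (colour_class (complete_graph N) c Red) T \<and>
    \<not> contains_copy (colour_class (complete_graph N) c Blue) (cycle_graph m)"
proof -
  let ?n = "card (verts T)"
  define side where "side x \<longleftrightarrow> x < ?n - 1" for x :: nat
  define c where "c e = (if \<exists>b. \<forall>x\<in>e. side x = b then Red else Blue)" for e
  have red: "c {x, y} = Red \<longleftrightarrow> side x = side y" for x y unfolding c_def by auto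
  have blue: "c {x, y} = Blue \<longleftrightarrow> side x \<noteq> side y" for x y
    using red[of x y] by (cases "c {x, y}") auto
  have verts: "verts (colour_class (complete_graph N) c k) = {..<N}" for k
    by (simp add: colour_class_def complete_graph_def)
  have "\<not> contains_copy (colour_class (complete_graph N) c Red) T"
  proof
    assume "contains_copy (colour_class (complete_graph N) c Red) T"
    then obtain f where inj: "inj_on f (verts T)"
      and f: "f ` verts T \<subseteq> verts (colour_class (complete_graph N) c Red)"
      and edge: "\<forall>x\<in>verts T. \<forall>y\<in>verts T. {x, y} \<in> edges T \<longrightarrow>
        {f x, f y} \<in> edges (colour_class (complete_graph N) c Red)"
      by (rule contains_copyE)
    have step: "side (f x) = side (f y)" if "{x, y} \<in> edges T" for x y
    proof -
      have "x \<in> verts T" "y \<in> verts T" using simple_graph_edgeD(1)[OF assms(2) that] by auto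
      then show ?thesis using edge that unfolding colour_class_edge_iff red by blast
    qed
    have conn: "side (f x) = side (f y)" if "(x, y) \<in> {(x, y). {x, y} \<in> edges T}\<^sup>*" for x y
      using that by (induction rule: rtrancl_induct) (auto dest: step)
    obtain r where r: "r \<in> verts T" using assms(3) unfolding connected_graph_def by blast
    then have same: "side (f x) = side (f r)" if "x \<in> verts T" for x
      using conn assms(3) that unfolding connected_graph_def by blast
    have "f ` verts T \<subseteq> {..<?n - 1} \<or> f ` verts T \<subseteq> {?n - 1..<N}"
    proof (cases "side (f r)")
      case True
      then have "f ` verts T \<subseteq> {..<?n - 1}" using same unfolding side_def by auto
      then show ?thesis ..
    next
      case False
      then have "f ` verts T \<subseteq> {?n - 1..<N}" using same f unfolding side_def verts by fastforce
      then show ?thesis ..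
    qed
    moreover have "card (f ` verts T) = ?n" using inj by (rule card_image)
    ultimately have "?n \<le> ?n - 1 \<or> ?n \<le> N - (?n - 1)"
      by (metis card_atLeastLessThan card_lessThan card_mono finite_atLeastLessThan finite_lessThan)
    moreover have "finite (verts T)" using assms(2) by (simp add: simple_graph_def)
    then have "?n > 0" using r card_gt_0_iff by blast
    ultimately show False using assms(4) by linarith
  qed
  moreover have "\<not> contains_copy (colour_class (complete_graph N) c Blue) (cycle_graph m)"
  proof
    assume "contains_copy (colour_class (complete_graph N) c Blue) (cycle_graph m)"
    then obtain f where
      edge: "\<forall>x\<in>verts (cycle_graph m). \<forall>y\<in>verts (cycle_graph m). {x, y} \<in> edges (cycle_graph m) \<longrightarrow>
        {f x, f y} \<in> edges (colour_class (complete_graph N) c Blue)"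
      by (rule contains_copyE)
    have m: "m > 0" using assms(1) by (cases m) auto
    have step: "side (f (Suc i mod m)) \<noteq> side (f i)" if "i < m" for i
    proof -
      have "{i, Suc i mod m} \<in> edges (cycle_graph m)" using that unfolding cycle_graph_def by auto
      moreover have "i \<in> verts (cycle_graph m)" "Suc i mod m \<in> verts (cycle_graph m)"
        using that m by (auto simp: cycle_graph_def)
      ultimately have "{f i, f (Suc i mod m)} \<in> edges (colour_class (complete_graph N) c Blue)"
        using edge by blast
      then show ?thesis unfolding colour_class_edge_iff blue by blast
    qed
    have alt: "i < m \<Longrightarrow> side (f i) \<longleftrightarrow> (side (f 0) \<longleftrightarrow> even i)" for i
    proof (induction i)
      case (Suc i)
      then show ?case using step[of i] by auto
    qed simp
    \<comment> \<open>As \<open>side\<close> alternates along the cycle, it agrees at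
      \<open>0\<close> and \<open>m - 1\<close>, which the closing edge forbids.\<close>
    have "even (m - 1)" using assms(1) by simp
    moreover have "m - 1 < m" using m by simp
    ultimately have "side (f (m - 1)) = side (f 0)" using alt by blast
    moreover have "Suc (m - 1) mod m = 0" using m by simp
    ultimately show False using step[of "m - 1"] m by simp
  qed
  ultimately show ?thesis by (intro exI conjI)
qed

theorem theorem5:
  fixes m n :: nat and T :: "'a ugraph"
  assumes "m \<ge> 3" and "odd m"
    and "n \<ge> 2 * m - 4"
    and "tree T" and "card (verts T) = n"
  shows "ramsey_number T (cycle_graph m) = 2 * n - 1"
proof -
  have n: "n \<ge> 2" using assms(1,3) by linarith
  have T: "simple_graph T" "connected_graph T" using assms(4) by (auto simp: tree_def)
  show ?thesis
    unfolding ramsey_number_def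
  proof (rule Least_equality)
    show "0 < 2 * n - 1 \<and> (\<forall>c. contains_copy (colour_class (complete_graph (2 * n - 1)) c Red) T \<or>
        contains_copy (colour_class (complete_graph (2 * n - 1)) c Blue) (cycle_graph m))"
      using tree_or_odd_cycle[OF assms(2,1,4)] assms(3,5) n by auto
  next
    fix N
    assume N: "0 < N \<and> (\<forall>c. contains_copy (colour_class (complete_graph N) c Red) T \<or>
        contains_copy (colour_class (complete_graph N) c Blue) (cycle_graph m))"
    show "2 * n - 1 \<le> N"
    proof (rule ccontr)
      assume "\<not> 2 * n - 1 \<le> N"
      then have "N + 2 \<le> 2 * card (verts T)" using assms(5) by linarith
      then show False using two_red_cliques_colouring[OF assms(2) T] N by blast
    qed
  qed
qed

end
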